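(* For $n\ge 0$ let $a(n)$ be the number of 6-tuples $(\pi_1,\dots,\pi_6)\in\mathcal{C}_{10,2}\times\mathcal{C}_{10,3}\times\mathcal{C}_{10,1}\times\mathcal{C}_{10,4}\times\mathcal{T}_{11}\times\mathcal{T}_{11}$ with $|\pi_1|+|\pi_2|+11|\pi_3|+11|\pi_4|+10|\pi_5|+10|\pi_6|=n$, and let $b(n)$ be the number of 6-tuples $(\pi_1,\dots,\pi_6)\in\mathcal{C}_{10,1}\times\mathcal{C}_{10,4}\times\mathcal{C}_{10,2}\times\mathcal{C}_{10,3}\times\mathcal{T}_{11}\times\mathcal{T}_{11}$ with the same weighted size $|\pi_1|+|\pi_2|+11|\pi_3|+11|\pi_4|+10|\pi_5|+10|\pi_6|=n$ (so $a(0)=b(0)=1$); set $b(-2)=b(-1)=0$. Let $\tau(n)$ be Ramanujan's tau function. Then for every integer $n\ge 1$: (i) $\tau(n)=a(110n-110)-b(110n-112)$; (ii) $a(n)-b(n-2)=0$ whenever $n\not\equiv 0 \pmod{110}$.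
   Context: Ramanujan's tau function is defined by $\sum_{n\ge1}\tau(n)q^n=q\prod_{j\ge1}(1-q^j)^{24}$. For a partition $\pi$, $|\pi|$ is the sum of its parts; the empty partition (of $0$) is included in all sets below. A partition $\lambda$ is a $t$-core if no hook of its Ferrers diagram has length divisible by $t$ (the hook of cell $(i,j)$ consists of the cell, the cells to its right in row $i$ and the cells below it in column $j$); $\mathcal{T}_t$ denotes the set of $t$-cores. Write a partition as $(1^{\mu_1},2^{\mu_2},\dots)$ with $\mu_j$ the multiplicity of part $j$. For $m\ge2$, $0<k<m$, an $(m,k)$-capsid is a partition whose parts are each equal to $m-k$ or congruent to $0$ or $k$ mod $m$, such that: (i) if $\mu_{m-k}=0$ then all parts are congruent to $k$ mod $m$; (ii) if $\mu_{m-k}>0$ then $m-k$ is the smallest part, every part congruent to $0$ mod $m$ is $\le m\mu_{m-k}$, and all parts congruent to $k$ mod $m$ (other than $m-k$ itself when $k=m/2$) are $>m\mu_{m-k}$. $\mathcal{C}_{m,k}$ denotes the set of $(m,k)$-capsids. *)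

theory Defs
  imports
    "HOL-Analysis.Analysis"
    "HOL-Library.Multiset"
    "HOL-Number_Theory.Cong"
begin

definition ramanujan_tau :: "nat \<Rightarrow> int" where
  "ramanujan_tau n = fps_nth (fps_X * (\<Prod>j. (1 - fps_X ^ Suc j) ^ 24)) n"

text \<open>The infinite product above is the limit of the partial products in the usual
  (coefficientwise) topology on formal power series; it does converge, so it is not a junk
  value.\<close>

lemma convergent_prod_tau:
  "convergent_prod (\<lambda>j. (1 - fps_X ^ Suc j) ^ 24 :: int fps)"
proof -
  define f :: "nat \<Rightarrow> int fps" where "f = (\<lambda>j. (1 - fps_X ^ Suc j) ^ 24)"
  define P where "P = (\<lambda>N. \<Prod>i\<le>N. f i)"
  have step: "fps_nth (P (Suc N)) n = fps_nth (P N) n" if "n \<le> N" for n N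
  proof -
    have "\<exists>g. (1 - u) ^ k = 1 - u * g" for u :: "int fps" and k :: nat
    proof (induction k)
      case 0
      show ?case by (intro exI[of _ 0]) simp
    next
      case (Suc k)
      then obtain g where g: "(1 - u) ^ k = 1 - u * g" by blast
      show ?case
        by (intro exI[of _ "1 + g - u * g"]) (simp add: g algebra_simps)
    qed
    then obtain g where g: "f (Suc N) = 1 - fps_X ^ Suc (Suc N) * g"
      unfolding f_def by blast
    have "P (Suc N) = P N * f (Suc N)"
      by (simp add: P_def mult.commute)
    then have "P (Suc N) = P N - fps_X ^ Suc (Suc N) * (P N * g)"
      unfolding g by (simp add: algebra_simps)
    then show ?thesis
      using that by (simp only: fps_sub_nth fps_X_power_mult_nth) simp
  qed
  have stable: "fps_nth (P N) n = fps_nth (P n) n" if "n \<le> N" for n N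
    using that by (induction N rule: dec_induct) (simp_all add: step)
  have lim: "P \<longlonglongrightarrow> Abs_fps (\<lambda>n. fps_nth (P n) n)"
  proof (rule tendsto_fpsI)
    fix n
    show "\<forall>\<^sub>F N in sequentially. fps_nth (P N) n = fps_nth (Abs_fps (\<lambda>n. fps_nth (P n) n)) n"
      unfolding eventually_sequentially fps_nth_Abs_fps using stable by blast
  qed
  have "fps_nth (P 0) 0 = 1"
    unfolding P_def f_def by (simp add: fps_nth_power_0)
  then have "Abs_fps (\<lambda>n. fps_nth (P n) n) \<noteq> 0"
    by (metis fps_nth_Abs_fps fps_zero_nth zero_neq_one)
  with lim have "raw_has_prod f 0 (Abs_fps (\<lambda>n. fps_nth (P n) n))"
    by (simp add: raw_has_prod_def P_def)
  then show ?thesis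
    unfolding convergent_prod_def f_def by blast
qed

text \<open>A partition is the multiset of its parts, so that \<^term>\<open>\<Sum>\<^sub># \<pi>\<close> is its size and
  \<^term>\<open>count \<pi> j\<close> the multiplicity of the part \<^term>\<open>j\<close>.\<close>

definition is_partition :: "nat multiset \<Rightarrow> bool" where
  "is_partition \<pi> \<longleftrightarrow> 0 \<notin># \<pi>"

text \<open>Rows and columns are counted from 0, and the rows are listed in weakly decreasing order.\<close>

definition ferrers :: "nat multiset \<Rightarrow> (nat \<times> nat) set" where
  "ferrers \<pi> =
    {(i, j). i < size \<pi> \<and> j < rev (sorted_list_of_multiset \<pi>) ! i}"

definition hook :: "nat multiset \<Rightarrow> nat \<times> nat \<Rightarrow> (nat \<times> nat) set" where
  "hook \<pi> c = {(i, j) \<in> ferrers \<pi>. i = fst c \<and> snd c \<le> j \<or> j = snd c \<and> fst c \<le> i}"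

definition cores :: "nat \<Rightarrow> nat multiset set" where
  "cores t = {\<pi>. is_partition \<pi> \<and> (\<forall>c \<in> ferrers \<pi>. \<not> t dvd card (hook \<pi> c))}"

definition capsids :: "nat \<Rightarrow> nat \<Rightarrow> nat multiset set" where
  "capsids m k = {\<pi>. is_partition \<pi> \<and>
     (\<forall>p \<in># \<pi>. p = m - k \<or> [p = 0] (mod m) \<or> [p = k] (mod m)) \<and>
     (count \<pi> (m - k) = 0 \<longrightarrow> (\<forall>p \<in># \<pi>. [p = k] (mod m))) \<and>
     (count \<pi> (m - k) > 0 \<longrightarrow>
       (\<forall>p \<in># \<pi>. m - k \<le> p) \<and>
       (\<forall>p \<in># \<pi>. [p = 0] (mod m) \<longrightarrow> p \<le> m * count \<pi> (m - k)) \<and>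
       (\<forall>p \<in># \<pi>. [p = k] (mod m) \<and> \<not> (2 * k = m \<and> p = m - k) \<longrightarrow>
          p > m * count \<pi> (m - k)))}"

fun weighted_size ::
  "nat multiset \<times> nat multiset \<times> nat multiset \<times> nat multiset \<times> nat multiset \<times> nat multiset \<Rightarrow> nat"
where
  "weighted_size (\<pi>1, \<pi>2, \<pi>3, \<pi>4, \<pi>5, \<pi>6) =
     \<Sum>\<^sub># \<pi>1 + \<Sum>\<^sub># \<pi>2 + 11 * \<Sum>\<^sub># \<pi>3 + 11 * \<Sum>\<^sub># \<pi>4 + 10 * \<Sum>\<^sub># \<pi>5 + 10 * \<Sum>\<^sub># \<pi>6"

definition count_a :: "nat \<Rightarrow> nat" where
  "count_a n = card {x \<in> capsids 10 2 \<times> capsids 10 3 \<times> capsids 10 1 \<times> capsids 10 4 \<times>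
                    cores 11 \<times> cores 11. weighted_size x = n}"

text \<open>The argument is an integer because the values at -2 and -1, which are 0, are needed.\<close>

definition count_b :: "int \<Rightarrow> nat" where
  "count_b n = (if n < 0 then 0
          else card {x \<in> capsids 10 1 \<times> capsids 10 4 \<times> capsids 10 2 \<times> capsids 10 3 \<times>
                          cores 11 \<times> cores 11. weighted_size x = nat n})"

text \<open>The sets counted by \<^const>\<open>count_a\<close> and \<^const>\<open>count_b\<close> are finite, so \<^const>\<open>card\<close> is their
  actual number of elements.\<close>

lemma finite_partitions_le: "finite {\<pi>. is_partition \<pi> \<and> \<Sum>\<^sub># \<pi> \<le> n}"
proof (rule finite_subset)
  show "finite (mset ` {xs. set xs \<subseteq> {..n} \<and> length xs \<le> n})"
    by (intro finite_imageI finite_lists_length_le) simp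
  show "{\<pi>. is_partition \<pi> \<and> \<Sum>\<^sub># \<pi> \<le> n} \<subseteq> mset ` {xs. set xs \<subseteq> {..n} \<and> length xs \<le> n}"
  proof
    fix \<pi> assume "\<pi> \<in> {\<pi>. is_partition \<pi> \<and> \<Sum>\<^sub># \<pi> \<le> n}"
    then have pos: "0 \<notin># \<pi>" and le: "\<Sum>\<^sub># \<pi> \<le> n"
      by (auto simp: is_partition_def)
    obtain xs where xs: "\<pi> = mset xs"
      by (metis ex_mset)
    have "length xs \<le> sum_list xs"
      using pos unfolding xs by (induction xs) auto
    moreover have "set xs \<subseteq> {..sum_list xs}"
      by (auto intro: member_le_sum_list)
    ultimately show "\<pi> \<in> mset ` {xs. set xs \<subseteq> {..n} \<and> length xs \<le> n}"
      using le unfolding xs sum_mset_sum_list by fastforce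
  qed
qed

lemma finite_weighted_size:
  assumes "\<And>\<pi>. \<pi> \<in> A \<union> B \<union> C \<union> D \<union> E \<union> F \<Longrightarrow> is_partition \<pi>"
  shows "finite {x \<in> A \<times> B \<times> C \<times> D \<times> E \<times> F. weighted_size x = n}"
proof (rule finite_subset)
  let ?S = "{\<pi>. is_partition \<pi> \<and> \<Sum>\<^sub># \<pi> \<le> n}"
  show "finite (?S \<times> ?S \<times> ?S \<times> ?S \<times> ?S \<times> ?S)"
    by (intro finite_cartesian_product finite_partitions_le)
  show "{x \<in> A \<times> B \<times> C \<times> D \<times> E \<times> F. weighted_size x = n} \<subseteq>
      ?S \<times> ?S \<times> ?S \<times> ?S \<times> ?S \<times> ?S"
    using assms by auto
qed

end

theory Submission
  imports Defs "HOL-Computational_Algebra.Formal_Laurent_Series"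
begin

text \<open>
  A \<open>(m, k)\<close>-capsid splits into its parts equal to \<open>m - k\<close>, its multiples of \<open>m\<close> and its parts congruent
  to \<open>k\<close>; by the q-binomial theorem the generating function is
  \<open>(q\<^sup>m; q\<^sup>m) / ((q\<^sup>k; q\<^sup>m) (q\<^bsup>m - k\<^esup>; q\<^sup>m))\<close>, all products being infinite. Hence the capsids with \<open>k = 1, 4\<close>
  and \<open>k = 2, 3\<close> produce the Rogers-Ramanujan functions \<open>G\<close> and \<open>H\<close>. The abacus turns partitions
  into subsets of the integers (Maya diagrams); splitting such a set into its residue classes modulo
  \<open>t\<close> gives \<open>(q\<^sup>t; q\<^sup>t)\<^sup>t / (q; q)\<close> for the \<open>t\<close>-cores, and counting Maya diagrams by charge gives the
  Jacobi triple product. Everything then reduces to Ramanujan's identity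
  \<open>H(q) G(q\<^bsup>11\<^esup>) - q\<^sup>2 G(q) H(q\<^bsup>11\<^esup>) = 1\<close>.

  With the triple product this becomes an identity between theta series of the binary form
  \<open>x\<^sup>2 + 11 y\<^sup>2\<close>. Since 15 is the norm of \<open>2 + \<surd>-11\<close>, both sides live on one and the same lattice and
  carry the same sign there: one side omits the points with \<open>5\<close> dividing \<open>y\<close>, the other one those
  lying on the corresponding sublattice of index 3, and a sign-reversing reflection shows that
  neither omission changes the sum.
\<close>

section \<open>Generating functions of weighted sets\<close>

unbundle no vec_syntax
unbundle fps_syntax

declare of_nat_sum [simp del] of_nat_sum_mset [simp del]

text \<open>Write phi(q) for the product of all 1 - q^j. The capsids with k = 1, 4 contribute
  phi(q^10)^2 G(q), those with k = 2, 3 contribute phi(q^10)^2 H(q), and the pair of weight 11 the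
  same in q^11. So after Ramanujan's identity a stray factor phi(q^10)^2 phi(q^110)^2 remains. The
  two 11-cores of weight 10 contribute phi(q^110)^22 / phi(q^10)^2: this removes phi(q^10) and
  completes the exponent 24 = 2 + 22 in the variable q^110. That explains the weights 10 and 11 and
  the number 110; the shift by 2 in \<open>count_b\<close> is the q^2 of the identity. Most
  identities of series are bijections or sign-reversing involutions on signed weighted sets, and
  quotients are avoided by multiplying with \<open>euler\<close>, whose inverse is
  \<open>part_gf\<close>. Weights are integers because the exponents arise as differences (energies
  of Maya diagrams) or as values of indefinite-looking polynomials; that they are nonnegative is
  part of \<open>graded\<close>.\<close>

definition gf :: "'a set \<Rightarrow> ('a \<Rightarrow> int) \<Rightarrow> ('a \<Rightarrow> int) \<Rightarrow> int fps" where
  "gf S s w = Abs_fps (\<lambda>n. \<Sum>x | x \<in> S \<and> w x = int n. s x)"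

text \<open>The sum over an infinite fibre is 0 by convention, so \<^term>\<open>gf S s w\<close> is meaningful only if the
  weight has finite fibres.\<close>

definition graded :: "'a set \<Rightarrow> ('a \<Rightarrow> int) \<Rightarrow> bool" where
  "graded S w \<longleftrightarrow> (\<forall>x\<in>S. 0 \<le> w x) \<and> (\<forall>n. finite {x. x \<in> S \<and> w x = int n})"

lemma gf_nth: "gf S s w $ n = (\<Sum>x | x \<in> S \<and> w x = int n. s x)"
  by (simp add: gf_def)

lemma gradedI:
  assumes "\<And>x. x \<in> S \<Longrightarrow> 0 \<le> w x" "\<And>n. finite {x. x \<in> S \<and> w x = int n}"
  shows "graded S w"
  using assms by (auto simp: graded_def)

lemma graded_finite: "graded S w \<Longrightarrow> finite {x. x \<in> S \<and> w x = int n}"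
  by (simp add: graded_def)

lemma graded_nonneg: "graded S w \<Longrightarrow> x \<in> S \<Longrightarrow> 0 \<le> w x"
  by (simp add: graded_def)

lemma gf_cong:
  assumes "S = T" "\<And>x. x \<in> T \<Longrightarrow> s x = s' x" "\<And>x. x \<in> T \<Longrightarrow> w x = w' x"
  shows "gf S s w = gf T s' w'"
  using assms by (intro fps_ext) (auto simp: gf_nth intro!: sum.cong)

lemma gf_reindex:
  assumes "bij_betw f S T" "\<And>x. x \<in> S \<Longrightarrow> s' (f x) = s x" "\<And>x. x \<in> S \<Longrightarrow> w' (f x) = w x"
  shows "gf S s w = gf T s' w'"
proof (rule fps_ext)
  fix n
  have "bij_betw f {x. x \<in> S \<and> w x = int n} {x. x \<in> T \<and> w' x = int n}"
    using assms(1,3) by (fastforce simp: bij_betw_def inj_on_def)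
  from sum.reindex_bij_betw[OF this, of s'] show "gf S s w $ n = gf T s' w' $ n"
    using assms(2) by (simp add: gf_nth)
qed

lemma graded_inj:
  assumes "inj_on f S" "f ` S \<subseteq> T" "\<And>x. x \<in> S \<Longrightarrow> w' (f x) = w x" "graded T w'"
  shows "graded S w"
proof (rule gradedI)
  show "0 \<le> w x" if "x \<in> S" for x
    using assms(2-4) that by (metis graded_def imageI subsetD)
  fix n
  have "f ` {x. x \<in> S \<and> w x = int n} \<subseteq> {x. x \<in> T \<and> w' x = int n}"
    using assms(2,3) by auto
  then have "finite (f ` {x. x \<in> S \<and> w x = int n})"
    using graded_finite[OF assms(4)] by (rule finite_subset)
  then show "finite {x. x \<in> S \<and> w x = int n}"
    by (rule finite_imageD) (use assms(1) in \<open>auto simp: inj_on_def\<close>)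
qed

lemma graded_subset: "graded T w \<Longrightarrow> S \<subseteq> T \<Longrightarrow> graded S w"
  by (rule graded_inj[of id S T w]) auto

lemma graded_bij:
  assumes "bij_betw f S T" "\<And>x. x \<in> S \<Longrightarrow> w' (f x) = w x" "graded S w"
  shows "graded T w'"
proof (rule graded_inj[OF _ _ _ assms(3)])
  note inv = bij_betw_inv_into[OF assms(1)]
  show "inj_on (inv_into S f) T"
    by (rule bij_betw_imp_inj_on[OF inv])
  show "inv_into S f ` T \<subseteq> S"
    using bij_betw_imp_surj_on[OF inv] by simp
  show "w (inv_into S f x) = w' x" if "x \<in> T" for x
    using assms(2)[of "inv_into S f x"] bij_betw_inv_into_right[OF assms(1) that]
      bij_betw_apply[OF inv that] by simp
qed

lemma gf_Un:
  assumes "graded (S \<union> T) w" "S \<inter> T = {}"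
  shows "gf (S \<union> T) s w = gf S s w + gf T s w"
proof (rule fps_ext)
  fix n
  have "{x. x \<in> S \<union> T \<and> w x = int n} = {x. x \<in> S \<and> w x = int n} \<union> {x. x \<in> T \<and> w x = int n}"
    by auto
  moreover have "finite {x. x \<in> S \<and> w x = int n}" "finite {x. x \<in> T \<and> w x = int n}"
    using assms(1) by (auto intro: graded_finite graded_subset)
  ultimately show "gf (S \<union> T) s w $ n = (gf S s w + gf T s w) $ n"
    using assms(2) by (auto simp: gf_nth intro!: sum.union_disjoint)
qed

text \<open>Nonnegative weights bound both degrees by \<open>n\<close>, so the fibre of a product is
  a finite disjoint union, with one piece for each term of the Cauchy product.\<close>

lemma fibre_times:
  assumes "graded S w" "graded T w'"
  shows "{p. p \<in> S \<times> T \<and> w (fst p) + w' (snd p) = int n} =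
    (\<Union>i\<in>{0..n}. {x. x \<in> S \<and> w x = int i} \<times> {x. x \<in> T \<and> w' x = int (n - i)})"
    (is "?L = ?R")
proof
  show "?L \<subseteq> ?R"
  proof
    fix p assume p: "p \<in> ?L"
    then have "0 \<le> w (fst p)" "0 \<le> w' (snd p)"
      using assms by (auto simp: graded_def)
    then show "p \<in> ?R"
      using p by (intro UN_I[of "nat (w (fst p))"]) (auto simp: mem_Times_iff)
  qed
qed auto

lemma graded_times:
  assumes "graded S w" "graded T w'"
  shows "graded (S \<times> T) (\<lambda>p. w (fst p) + w' (snd p))"
proof (rule gradedI)
  show "finite {p. p \<in> S \<times> T \<and> w (fst p) + w' (snd p) = int n}" for n
    unfolding fibre_times[OF assms] using assms by (intro finite_UN_I finite_cartesian_product graded_finite) auto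
qed (use assms in \<open>auto simp: graded_def\<close>)

lemma gf_times:
  assumes "graded S w" "graded T w'"
  shows "gf S s w * gf T s' w' =
    gf (S \<times> T) (\<lambda>p. s (fst p) * s' (snd p)) (\<lambda>p. w (fst p) + w' (snd p))"
proof (rule fps_ext)
  fix n
  let ?S = "\<lambda>i. {x. x \<in> S \<and> w x = int i}" and ?T = "\<lambda>i. {x. x \<in> T \<and> w' x = int i}"
  have fin: "finite (?S i)" "finite (?T i)" for i
    using assms by (simp_all add: graded_def)
  have "(gf S s w * gf T s' w') $ n = (\<Sum>i=0..n. (\<Sum>x\<in>?S i. s x) * (\<Sum>y\<in>?T (n - i). s' y))"
    by (simp add: fps_mult_nth gf_nth)
  also have "\<dots> = (\<Sum>i=0..n. \<Sum>p\<in>?S i \<times> ?T (n - i). s (fst p) * s' (snd p))"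
    by (simp add: sum_product sum.cartesian_product case_prod_beta)
  also have "\<dots> = (\<Sum>p\<in>(\<Union>i\<in>{0..n}. ?S i \<times> ?T (n - i)). s (fst p) * s' (snd p))"
    using fin by (subst sum.UNION_disjoint) (auto simp del: of_nat_diff)
  also have "\<dots> = gf (S \<times> T) (\<lambda>p. s (fst p) * s' (snd p)) (\<lambda>p. w (fst p) + w' (snd p)) $ n"
    by (simp only: gf_nth fibre_times[OF assms])
  finally show "(gf S s w * gf T s' w') $ n = \<dots>" .
qed

text \<open>Each coefficient equals its own negative, and the integers have no 2-torsion. A fixed
  point of \<open>f\<close> would have sign 0 and does no harm.\<close>

lemma gf_involution:
  assumes "\<And>x. x \<in> S \<Longrightarrow> f x \<in> S" "\<And>x. x \<in> S \<Longrightarrow> f (f x) = x"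
    and "\<And>x. x \<in> S \<Longrightarrow> s (f x) = - s x" "\<And>x. x \<in> S \<Longrightarrow> w (f x) = w x"
  shows "gf S s w = 0"
proof -
  have "bij_betw f S S"
    using assms(1,2) by (intro bij_betwI[of _ _ _ f]) auto
  then have "gf S s w = gf S (\<lambda>x. - s x) w"
    by (rule gf_reindex) (use assms(3,4) in auto)
  also have "\<dots> = - gf S s w"
    by (rule fps_ext) (simp add: gf_nth sum_negf)
  finally show ?thesis
    by (simp add: fps_eq_iff)
qed

lemma gf_uminus: "gf S (\<lambda>x. - s x) w = - gf S s w"
  by (rule fps_ext) (simp add: gf_nth sum_negf)

lemma gf_X_power:
  assumes "graded S w"
  shows "fps_X ^ d * gf S s w = gf S s (\<lambda>x. int d + w x)"
proof (rule fps_ext)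
  fix n
  show "(fps_X ^ d * gf S s w) $ n = gf S s (\<lambda>x. int d + w x) $ n"
  proof (cases "n < d")
    case True
    then have "{x. x \<in> S \<and> int d + w x = int n} = {}"
      using graded_nonneg[OF assms] by fastforce
    then have "gf S s (\<lambda>x. int d + w x) $ n = 0"
      unfolding gf_nth by (simp only: sum.empty)
    then show ?thesis
      using True by (simp add: fps_X_power_mult_nth)
  next
    case False
    then have "{x. x \<in> S \<and> w x = int (n - d)} = {x. x \<in> S \<and> int d + w x = int n}"
      by (auto simp: of_nat_diff)
    then show ?thesis
      using False unfolding fps_X_power_mult_nth gf_nth by simp
  qed
qed

lemma gf_singleton: "gf {x} s (\<lambda>_. int n) = fps_const (s x) * fps_X ^ n"
proof (rule fps_ext)
  fix k
  have "{y. y = x \<and> n = k} = (if n = k then {x} else {})"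
    by auto
  then show "gf {x} s (\<lambda>_. int n) $ k = (fps_const (s x) * fps_X ^ n) $ k"
    by (simp add: gf_nth)
qed

lemma gf_PiE:
  assumes "finite I" "graded S w"
  shows "graded (PiE I (\<lambda>_. S)) (\<lambda>F. \<Sum>i\<in>I. w (F i)) \<and>
    gf (PiE I (\<lambda>_. S)) (\<lambda>_. 1) (\<lambda>F. \<Sum>i\<in>I. w (F i)) = gf S (\<lambda>_. 1) w ^ card I"
  using assms(1)
proof induction
  case empty
  have "graded {\<lambda>x. undefined} (\<lambda>F. 0)"
    by (auto simp: graded_def)
  then show ?case
    using gf_singleton[of "\<lambda>_. undefined" "\<lambda>_. 1" 0] by simp
next
  case (insert i I)
  let ?f = "\<lambda>(y, g). g(i := y)"
  let ?w = "\<lambda>p. w (fst p) + (\<Sum>i\<in>I. w (snd p i))"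
  have bij: "bij_betw ?f (S \<times> PiE I (\<lambda>_. S)) (PiE (insert i I) (\<lambda>_. S))"
    using insert.hyps by (auto simp: bij_betw_def PiE_insert_eq intro!: inj_combinator)
  have w: "(\<Sum>j\<in>insert i I. w (?f p j)) = ?w p" if "p \<in> S \<times> PiE I (\<lambda>_. S)" for p
    using insert.hyps by (auto simp: case_prod_beta intro!: sum.cong)
  have gr: "graded (S \<times> PiE I (\<lambda>_. S)) ?w"
    by (rule graded_times) (use insert assms in auto)
  have "graded (PiE (insert i I) (\<lambda>_. S)) (\<lambda>F. \<Sum>i\<in>insert i I. w (F i))"
    using w by (rule graded_bij[OF bij _ gr])
  moreover have "gf (S \<times> PiE I (\<lambda>_. S)) (\<lambda>_. 1 * 1) ?w =
      gf (PiE (insert i I) (\<lambda>_. S)) (\<lambda>_. 1) (\<lambda>F. \<Sum>i\<in>insert i I. w (F i))"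
    using w by (intro gf_reindex[OF bij]) simp_all
  ultimately show ?case
    using gf_times[OF assms(2), of "PiE I (\<lambda>_. S)" "\<lambda>F. \<Sum>i\<in>I. w (F i)" "\<lambda>_. 1" "\<lambda>_. 1"] insert
    by (simp add: mult.commute)
qed

lemma graded_scale:
  assumes "graded S w" "c > 0"
  shows "graded S (\<lambda>x. int c * w x)"
proof (rule gradedI)
  show "0 \<le> int c * w x" if "x \<in> S" for x
    using assms that by (simp add: graded_def)
  show "finite {x. x \<in> S \<and> int c * w x = int n}" for n
  proof (rule finite_subset)
    show "finite {x. x \<in> S \<and> w x = int (n div c)}"
      using assms by (simp add: graded_def)
    show "{x. x \<in> S \<and> int c * w x = int n} \<subseteq> {x. x \<in> S \<and> w x = int (n div c)}"
    proof clarify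
      fix x assume "int c * w x = int n"
      then have "int n div int c = w x"
        using assms(2) by (metis nonzero_mult_div_cancel_left of_nat_0_eq_iff less_not_refl)
      then show "w x = int (n div c)"
        by (simp add: zdiv_int)
    qed
  qed
qed

lemma gf_scale:
  assumes "graded S w" "c > 0"
  shows "gf S s (\<lambda>x. int c * w x) = gf S s w oo fps_X ^ c"
proof (rule fps_ext)
  fix n
  show "gf S s (\<lambda>x. int c * w x) $ n = (gf S s w oo fps_X ^ c) $ n"
  proof (cases "c dvd n")
    case True
    then obtain k where "n = c * k" ..
    then show ?thesis
      using assms by (simp add: fps_nth_compose_X_power gf_nth)
  next
    case False
    then have "{x. x \<in> S \<and> int c * w x = int n} = {}"
      by (metis (mono_tags, lifting) Collect_empty_eq dvd_triv_left int_dvd_int_iff)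
    then have "gf S s (\<lambda>x. int c * w x) $ n = 0"
      unfolding gf_nth by (simp only: sum.empty)
    then show ?thesis
      using False by (simp add: fps_nth_compose_X_power)
  qed
qed

section \<open>Infinite products and partitions with restricted parts\<close>

text \<open>The formal product of \<open>1 - X\<^sup>j\<close> over \<open>j \<in> J\<close>, already expanded.\<close>

definition euler :: "nat set \<Rightarrow> int fps" where
  "euler J = gf (Fpow J) (\<lambda>A. (- 1) ^ card A) (\<lambda>A. int (\<Sum>A))"

definition part_gf :: "nat set \<Rightarrow> int fps" where
  "part_gf J = gf {\<pi>. set_mset \<pi> \<subseteq> J} (\<lambda>_. 1) (\<lambda>\<pi>. int (\<Sum>\<^sub># \<pi>))"

lemma subset_atMost_sum: "finite A \<Longrightarrow> A \<subseteq> {..\<Sum>A :: nat}"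
  by (auto intro: member_le_sum)

lemma graded_Fpow: "graded (Fpow J) (\<lambda>A. int (\<Sum>A))"
proof (rule gradedI)
  show "finite {A. A \<in> Fpow J \<and> int (\<Sum>A) = int n}" for n
    by (rule finite_subset[of _ "Pow {..n}"]) (use subset_atMost_sum in \<open>auto simp: Fpow_def\<close>)
qed simp

lemma graded_partitions: "0 \<notin> J \<Longrightarrow> graded {\<pi>. set_mset \<pi> \<subseteq> J} (\<lambda>\<pi>. int (\<Sum>\<^sub># \<pi>))"
proof (rule gradedI)
  show "finite {\<pi>. \<pi> \<in> {\<pi>. set_mset \<pi> \<subseteq> J} \<and> int (\<Sum>\<^sub># \<pi>) = int n}" if "0 \<notin> J" for n
    by (rule finite_subset[OF _ finite_partitions_le[of n]]) (use that in \<open>auto simp: is_partition_def\<close>)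
qed simp

text \<open>Factors may be indexed by something other than their exponents: by \<open>J\<close> for
  the dilation X -> X^c, and by the nonnegative or the negative integers for the two halves of a
  Maya diagram.\<close>

lemma euler_image:
  assumes "inj_on f I"
  shows "gf (Fpow I) (\<lambda>A. (- 1) ^ card A) (\<lambda>A. int (\<Sum>x\<in>A. f x)) = euler (f ` I)"
  unfolding euler_def
proof (rule gf_reindex)
  show "bij_betw (image f) (Fpow I) (Fpow (f ` I))"
    unfolding bij_betw_def
  proof
    show "inj_on (image f) (Fpow I)"
      using assms by (rule inj_on_image_Fpow)
    show "image f ` Fpow I = Fpow (f ` I)"
    proof (intro equalityI subsetI)
      fix B assume "B \<in> Fpow (f ` I)"
      then obtain A where "A \<subseteq> I" "finite A" "B = f ` A"
        using finite_subset_image[of B f I] by (auto simp: Fpow_def)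
      then show "B \<in> image f ` Fpow I"
        by (auto simp: Fpow_def)
    qed (auto simp: Fpow_def)
  qed
  show "(- 1) ^ card (f ` A) = (- 1) ^ card A" "int (\<Sum>(f ` A)) = int (\<Sum>x\<in>A. f x)" if "A \<in> Fpow I" for A
  proof -
    have "inj_on f A"
      using assms that by (auto simp: Fpow_def inj_on_subset)
    then show "(- 1) ^ card (f ` A) = (- 1) ^ card A" "int (\<Sum>(f ` A)) = int (\<Sum>x\<in>A. f x)"
      by (simp_all add: card_image sum.reindex)
  qed
qed

lemma euler_Un:
  assumes "J \<inter> K = {}"
  shows "euler (J \<union> K) = euler J * euler K"
proof -
  have "euler J * euler K = euler (J \<union> K)"
    unfolding euler_def gf_times[OF graded_Fpow graded_Fpow]
  proof (rule gf_reindex)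
    show "bij_betw (\<lambda>(A, B). A \<union> B) (Fpow J \<times> Fpow K) (Fpow (J \<union> K))"
      using assms by (intro bij_betwI[of _ _ _ "\<lambda>C. (C \<inter> J, C \<inter> K)"]) (auto simp: Fpow_def)
    fix p assume "p \<in> Fpow J \<times> Fpow K"
    then obtain A B where p: "p = (A, B)" "finite A" "finite B" "A \<subseteq> J" "B \<subseteq> K"
      by (auto simp: Fpow_def)
    then have "A \<inter> B = {}"
      using assms by blast
    with p show "(- 1) ^ card (case p of (A, B) \<Rightarrow> A \<union> B) = (- 1) ^ card (fst p) * (- 1 :: int) ^ card (snd p)"
      "int (\<Sum>(case p of (A, B) \<Rightarrow> A \<union> B)) = int (\<Sum>(fst p)) + int (\<Sum>(snd p))"
      by (simp_all add: card_Un_disjoint power_add sum.union_disjoint)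
  qed
  then show ?thesis ..
qed

lemma euler_singleton: "euler {j} = 1 - fps_X ^ j"
proof -
  have F: "Fpow {j} = {{}} \<union> {{j}}"
    by (auto simp: Fpow_def)
  have "euler {j} = gf {{}} (\<lambda>A. (- 1) ^ card A) (\<lambda>A. int (\<Sum>A)) + gf {{j}} (\<lambda>A. (- 1) ^ card A) (\<lambda>A. int (\<Sum>A))"
    unfolding euler_def F using graded_Fpow[of "{j}"] by (intro gf_Un) (simp_all add: F)
  also have "gf {{}} (\<lambda>A. (- 1) ^ card A) (\<lambda>A. int (\<Sum>A)) = gf {{}} (\<lambda>A. (- 1) ^ card A) (\<lambda>A::nat set. int 0)"
    by (rule gf_cong) auto
  also have "gf {{j}} (\<lambda>A. (- 1) ^ card A) (\<lambda>A. int (\<Sum>A)) = gf {{j}} (\<lambda>A. (- 1) ^ card A) (\<lambda>A. int j)"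
    by (rule gf_cong) auto
  finally show ?thesis
    unfolding gf_singleton by (simp flip: fps_const_neg)
qed

lemma euler_empty: "euler {} = 1"
proof -
  have "euler {} = gf {{}} (\<lambda>A. (- 1) ^ card A) (\<lambda>A :: nat set. int 0)"
    unfolding euler_def by (rule gf_cong) (auto simp: Fpow_def)
  then show ?thesis
    unfolding gf_singleton by simp
qed

lemma euler_finite: "finite J \<Longrightarrow> euler J = (\<Prod>j\<in>J. 1 - fps_X ^ j)"
proof (induction rule: finite_induct)
  case (insert j J)
  then show ?case
    using euler_Un[of "{j}" J] by (simp add: euler_singleton)
qed (simp add: euler_empty)

lemma euler_scale:
  assumes "c > 0"
  shows "euler J oo fps_X ^ c = euler ((*) c ` J)"
proof -
  have "euler J oo fps_X ^ c = gf (Fpow J) (\<lambda>A. (- 1) ^ card A) (\<lambda>A. int c * int (\<Sum>A))"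
    unfolding euler_def using assms by (simp add: gf_scale graded_Fpow)
  also have "\<dots> = gf (Fpow J) (\<lambda>A. (- 1) ^ card A) (\<lambda>A. int (\<Sum>x\<in>A. c * x))"
    by (rule gf_cong) (simp_all flip: sum_distrib_left)
  also have "\<dots> = euler ((*) c ` J)"
    by (rule euler_image) (use assms in \<open>auto simp: inj_on_def\<close>)
  finally show ?thesis .
qed

lemma euler_nth_cong:
  assumes "J \<inter> {..n} = K \<inter> {..n}"
  shows "euler J $ n = euler K $ n"
proof -
  have "{A. A \<in> Fpow J \<and> \<Sum>A = n} = {A. A \<in> Fpow K \<and> \<Sum>A = n}"
    using assms subset_atMost_sum by (fastforce simp: Fpow_def)
  then show ?thesis
    by (simp add: euler_def gf_nth)
qed

text \<open>The involution moves the smallest element of \<open>A \<union> \<pi>\<close> between the set and the multiset.\<close>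

lemma euler_part_gf:
  assumes "0 \<notin> J"
  shows "euler J * part_gf J = 1"
proof -
  let ?S = "Fpow J \<times> {\<pi>. set_mset \<pi> \<subseteq> J}"
  let ?s = "\<lambda>p. (- 1 :: int) ^ card (fst p :: nat set) * (1 :: int)"
  let ?w = "\<lambda>p. int (\<Sum>(fst p)) + int (\<Sum>\<^sub># (snd p))"
  let ?T = "?S - {({}, {#})}"
  define f :: "nat set \<times> nat multiset \<Rightarrow> nat set \<times> nat multiset" where
    "f = (\<lambda>(A, \<pi>). let x = Min (A \<union> set_mset \<pi>) in
       if x \<in> A then (A - {x}, add_mset x \<pi>) else (insert x A, \<pi> - {#x#}))"
  have S: "?S = {({}, {#})} \<union> ?T"
    by (auto simp: Fpow_def)
  have gr: "graded ?S ?w"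
    by (intro graded_times graded_Fpow graded_partitions assms)
  have main: "f p \<in> ?T \<and> f (f p) = p \<and> ?s (f p) = - ?s p \<and> ?w (f p) = ?w p" if "p \<in> ?T" for p
  proof -
    obtain A \<pi> where p0: "p = (A, \<pi>)"
      by (cases p)
    then have p: "p = (A, \<pi>)" "finite A" "A \<subseteq> J" "set_mset \<pi> \<subseteq> J" "A \<union> set_mset \<pi> \<noteq> {}"
      using that by (auto simp: Fpow_def)
    define x where "x = Min (A \<union> set_mset \<pi>)"
    have x: "x \<in> A \<union> set_mset \<pi>"
      unfolding x_def using p by (intro Min_in) auto
    \<comment> \<open>A move does not change the union of the two components, so the second
      application of \<open>f\<close> selects the same \<open>x\<close> and undoes the
      first.\<close>
    have fx: "f (C, \<rho>) = (if x \<in> C then (C - {x}, add_mset x \<rho>) else (insert x C, \<rho> - {#x#}))"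
      if "C \<union> set_mset \<rho> = A \<union> set_mset \<pi>" for C \<rho>
      by (simp add: f_def that x_def Let_def)
    show ?thesis
    proof (cases "x \<in> A")
      case True
      then obtain B where B: "A = insert x B" "x \<notin> B"
        by (metis mk_disjoint_insert)
      have f: "f p = (B, add_mset x \<pi>)"
        unfolding p0 fx[OF refl] using B by simp
      have "B \<union> set_mset (add_mset x \<pi>) = A \<union> set_mset \<pi>"
        using B by auto
      then have "f (f p) = p"
        unfolding f using B by (simp add: fx p0)
      moreover have "card A = Suc (card B)" "\<Sum>A = x + \<Sum>B" "finite B" "B \<subseteq> J" "x \<in> J"
        using p B by auto
      ultimately show ?thesis
        unfolding f using p by (auto simp: Fpow_def)
    next
      case False
      then have "x \<in># \<pi>"
        using x by auto
      then obtain \<rho> where \<rho>: "\<pi> = add_mset x \<rho>"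
        by (metis insert_DiffM)
      have f: "f p = (insert x A, \<rho>)"
        unfolding p0 fx[OF refl] using False \<rho> by simp
      have "insert x A \<union> set_mset \<rho> = A \<union> set_mset \<pi>"
        by (auto simp: \<rho>)
      then have "f (f p) = p"
        unfolding f using False \<rho> by (simp add: fx p0)
      then show ?thesis
        unfolding f using False p by (auto simp: Fpow_def \<rho>)
    qed
  qed
  have "euler J * part_gf J = gf ?S ?s ?w"
    unfolding euler_def part_gf_def by (intro gf_times graded_Fpow graded_partitions assms)
  also have "\<dots> = gf {({}, {#})} ?s ?w + gf ?T ?s ?w"
    by (subst S, rule gf_Un) (use gr S in auto)
  also have "gf ?T ?s ?w = 0"
    by (rule gf_involution[of _ f]) (use main in blast)+
  also have "gf {({}, {#})} ?s ?w = gf {({}, {#})} ?s (\<lambda>_ :: nat set \<times> nat multiset. int 0)"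
    by (rule gf_cong) auto
  finally show ?thesis
    unfolding gf_singleton by simp
qed

section \<open>Congruence of power series modulo a power of the variable\<close>

definition fps_eq_upto :: "nat \<Rightarrow> 'a::comm_ring_1 fps \<Rightarrow> 'a fps \<Rightarrow> bool" where
  "fps_eq_upto N f g \<longleftrightarrow> (\<forall>n<N. f $ n = g $ n)"

lemma fps_eq_upto_refl: "fps_eq_upto N f f"
  by (simp add: fps_eq_upto_def)

lemma fps_eq_upto_trans: "fps_eq_upto N f g \<Longrightarrow> fps_eq_upto N g h \<Longrightarrow> fps_eq_upto N f h"
  by (simp add: fps_eq_upto_def)

lemma fps_eq_upto_sym: "fps_eq_upto N f g \<Longrightarrow> fps_eq_upto N g f"
  by (simp add: fps_eq_upto_def)

lemma fps_eq_upto_mult: "fps_eq_upto N f g \<Longrightarrow> fps_eq_upto N f' g' \<Longrightarrow> fps_eq_upto N (f * f') (g * g')"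
  by (auto simp: fps_eq_upto_def fps_mult_nth intro!: sum.cong)

lemma fps_eq_upto_power: "fps_eq_upto N f g \<Longrightarrow> fps_eq_upto N (f ^ k) (g ^ k)"
  by (induction k) (auto intro: fps_eq_upto_mult fps_eq_upto_refl)

lemma fps_eq_upto_X_power: "N \<le> M \<Longrightarrow> fps_eq_upto N (fps_X ^ M * f) 0"
  by (auto simp: fps_eq_upto_def fps_X_power_mult_nth)

lemma fps_eq_uptoI: "(\<And>N. fps_eq_upto N f g) \<Longrightarrow> f = g"
  by (auto simp: fps_eq_upto_def fps_eq_iff)

lemma euler_eq_upto: "J \<inter> {..<N} = K \<inter> {..<N} \<Longrightarrow> fps_eq_upto N (euler J) (euler K)"
  unfolding fps_eq_upto_def by (intro allI impI euler_nth_cong) fastforce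

text \<open>Links the topological product in the definition of tau with the combinatorial
  \<open>euler\<close>: the partial products are \<open>euler {1..Suc N}\<close>, and these agree
  with the limit up to degree \<open>N\<close>.\<close>

lemma tau_prodinf: "(\<Prod>j. (1 - fps_X ^ Suc j) ^ 24) = euler {1..} ^ 24"
proof -
  let ?f = "\<lambda>j. (1 - fps_X ^ Suc j :: int fps) ^ 24"
  have P: "(\<Prod>i\<le>N. ?f i) = euler {1..Suc N} ^ 24" for N
  proof -
    have "{1..Suc N} = Suc ` {..N}"
      by (simp add: image_Suc_atMost)
    then have "euler {1..Suc N} = (\<Prod>i\<le>N. 1 - fps_X ^ Suc i)"
      by (simp add: euler_finite prod.reindex)
    then show ?thesis
      by (simp add: prod_power_distrib)
  qed
  have "(\<lambda>N. \<Prod>i\<le>N. ?f i) \<longlonglongrightarrow> euler {1..} ^ 24"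
  proof (rule tendsto_fpsI)
    fix n
    have "(\<Prod>i\<le>N. ?f i) $ n = (euler {1..} ^ 24) $ n" if "n \<le> N" for N
    proof -
      have "fps_eq_upto (Suc N) (euler {1..Suc N}) (euler {1..})"
        by (rule euler_eq_upto) auto
      then have "fps_eq_upto (Suc N) (euler {1..Suc N} ^ 24) (euler {1..} ^ 24)"
        by (rule fps_eq_upto_power)
      then show ?thesis
        unfolding P using that by (simp add: fps_eq_upto_def)
    qed
    then show "\<forall>\<^sub>F N in sequentially. (\<Prod>i\<le>N. ?f i) $ n = (euler {1..} ^ 24) $ n"
      unfolding eventually_sequentially by blast
  qed
  \<comment> \<open>\<open>raw_has_prod\<close> asks for a nonzero limit; here the limit is even
    invertible.\<close>
  moreover have "euler {1..} ^ 24 \<noteq> 0"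
    using euler_part_gf[of "{1..}"] by auto
  ultimately have "?f has_prod (euler {1..} ^ 24)"
    by (simp add: has_prod_def raw_has_prod_def)
  then show ?thesis
    using has_prod_unique by metis
qed

section \<open>Maya diagrams\<close>

definition maya :: "int set \<Rightarrow> bool" where
  "maya S \<longleftrightarrow> finite (S \<inter> {0..}) \<and> finite ({..<0} - S)"

text \<open>The sum of \<open>k + m x\<close> over all integers \<open>x\<close>, weighted by the difference of the indicators of \<open>S\<close> and
  of the vacuum \<open>{..<0}\<close>. The charge of \<open>S\<close> is \<open>energy 0 1 S\<close>.\<close>

definition energy :: "int \<Rightarrow> int \<Rightarrow> int set \<Rightarrow> int" where
  "energy m k S = (\<Sum>x\<in>S \<inter> {0..}. k + m * x) - (\<Sum>x\<in>{..<0} - S. k + m * x)"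

text \<open>The binomial coefficient "c choose 2" for every integer \<open>c\<close>. It is
  \<open>energy 1 0 {..<c}\<close>, the energy of the vacuum shifted to charge
  \<open>c\<close>.\<close>

definition tri :: "int \<Rightarrow> int" where
  "tri c = c * (c - 1) div 2"

lemma two_tri: "2 * tri c = c * (c - 1)"
  by (simp add: tri_def)

lemma tri_step: "tri (c + 1) = tri c + c"
  using two_tri[of c] two_tri[of "c + 1"] by (simp add: algebra_simps)

text \<open>A new bead at \<open>s\<close> counts \<open>k + m * s\<close> on either side of 0: for
  \<open>s \<ge> 0\<close> it enters the first sum, for \<open>s < 0\<close> it fills a hole and
  leaves the subtracted one.\<close>

lemma maya_insert:
  assumes "maya S" "s \<notin> S"
  shows "maya (insert s S)" "energy m k (insert s S) = energy m k S + k + m * s"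
proof -
  show "maya (insert s S)"
    using assms by (auto simp: maya_def Int_insert_left elim: rev_finite_subset)
  show "energy m k (insert s S) = energy m k S + k + m * s"
  proof (cases "s \<ge> 0")
    case True
    then have "insert s S \<inter> {0..} = insert s (S \<inter> {0..})" "{..<0} - insert s S = {..<0} - S"
      by auto
    then show ?thesis
      using assms by (simp add: energy_def maya_def)
  next
    case False
    then have *: "insert s S \<inter> {0..} = S \<inter> {0..}" "{..<0} - insert s S = ({..<0} - S) - {s}"
      and "s \<in> {..<0} - S"
      using assms by auto
    then show ?thesis
      using assms(1) sum.remove[of "{..<0} - S" s "\<lambda>x. k + m * x"] unfolding energy_def *
      by (simp add: maya_def)
  qed
qed

lemma maya_remove:
  assumes "maya S"
  shows "maya (S - {s})"
proof -
  have "{..<0} - (S - {s}) \<subseteq> insert s ({..<0} - S)" "(S - {s}) \<inter> {0..} \<subseteq> S \<inter> {0..}"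
    by auto
  then show ?thesis
    using assms unfolding maya_def by (meson finite_insert finite_subset)
qed

lemma maya_lessThan: "maya {..<c}"
proof -
  have "{..<c} \<inter> {0..} \<subseteq> {0..c}" "{..<0} - {..<c} \<subseteq> {c..0}"
    by auto
  then show ?thesis
    unfolding maya_def by (meson finite_atLeastAtMost_int finite_subset)
qed

lemma energy_lessThan: "energy m k {..<c} = k * c + m * tri c"
proof (induction c rule: int_induct[of _ 0])
  case base
  then show ?case
    by (auto simp: energy_def tri_def intro: sum.neutral)
next
  case (step1 c)
  have "{..<c + 1} = insert c {..<c}"
    by auto
  then show ?case
    using maya_insert(2)[OF maya_lessThan, of c c m k] step1 by (simp add: tri_step ring_distribs)
next
  case (step2 c)
  have "{..<c} = insert (c - 1) {..<c - 1}"
    by auto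
  moreover have "tri c = tri (c - 1) + (c - 1)"
    using tri_step[of "c - 1"] by simp
  ultimately show ?case
    using maya_insert(2)[OF maya_lessThan, of "c - 1" "c - 1" m k] step2
    by (simp add: ring_distribs)
qed

lemma maya_bounded_above:
  assumes "maya S"
  obtains b where "S \<subseteq> {..b}"
proof -
  have "S \<subseteq> {..Max (insert 0 (S \<inter> {0..}))}"
  proof
    fix x assume "x \<in> S"
    then show "x \<in> {..Max (insert 0 (S \<inter> {0..}))}"
      using assms by (cases "x \<ge> 0") (auto simp: maya_def intro: Max_ge order.trans[of x 0])
  qed
  then show ?thesis
    by (rule that)
qed

lemma maya_bounded_below:
  assumes "maya S"
  obtains b where "{..<b} \<subseteq> S"
proof -
  have "{..<Min (insert 0 ({..<0} - S))} \<subseteq> S"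
    using assms by (auto simp: maya_def)
  then show ?thesis
    by (rule that)
qed

lemma maya_max:
  assumes "maya S"
  shows "\<exists>s\<in>S. \<forall>x\<in>S. x \<le> s"
proof -
  obtain a where a: "{..<a} \<subseteq> S"
    using assms by (rule maya_bounded_below)
  obtain b where b: "S \<subseteq> {..b}"
    using assms by (rule maya_bounded_above)
  have fin: "finite (S \<inter> {a - 1..})"
    by (rule finite_subset[of _ "{a - 1..b}"]) (use b in auto)
  have ne: "a - 1 \<in> S \<inter> {a - 1..}"
    using a by auto
  define s where "s = Max (S \<inter> {a - 1..})"
  have s: "s \<in> S \<inter> {a - 1..}"
    unfolding s_def using fin ne by (intro Max_in) auto
  show ?thesis
  proof (intro bexI ballI)
    show "s \<in> S"
      using s by simp
    show "x \<le> s" if "x \<in> S" for x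
      using s Max_ge[OF fin, of x] that by (cases "x \<ge> a - 1") (auto simp: s_def[symmetric])
  qed
qed

text \<open>There is a largest bead, closure fills everything below it, and the charge of a
  half-line is its exclusive upper bound.\<close>

lemma maya_down_closed:
  assumes "maya S" "\<And>x. x \<in> S \<Longrightarrow> x - 1 \<in> S"
  shows "S = {..<energy 0 1 S}"
proof -
  obtain s where s: "s \<in> S" "\<And>x. x \<in> S \<Longrightarrow> x \<le> s"
    using maya_max[OF assms(1)] by blast
  have "s - int n \<in> S" for n
  proof (induction n)
    case (Suc n)
    then show ?case
      using assms(2)[of "s - int n"] by (simp add: algebra_simps)
  qed (use s in simp)
  then have "x \<in> S" if "x \<le> s" for x
    using that by (metis diff_diff_eq2 add_diff_cancel_left' diff_ge_0_iff_ge int_nat_eq)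
  with s(2) have S: "S = {..<s + 1}"
    by (auto simp: zless_add1_eq)
  show ?thesis
    using energy_lessThan[of 0 1 "s + 1"] S by simp
qed

text \<open>For parts \<open>x\<^sub>0 \<ge> x\<^sub>1 \<ge> \<dots>\<close>, continued by zeros, this is the set of all \<open>x\<^sub>i - i - 1 + c\<close>.\<close>

fun beads :: "nat list \<Rightarrow> int \<Rightarrow> int set" where
  "beads [] c = {..<c}"
| "beads (x # xs) c = insert (int x - 1 + c) (beads xs (c - 1))"

definition part_lists :: "nat list set" where
  "part_lists = {xs. sorted_wrt (\<ge>) xs \<and> 0 \<notin> set xs}"

lemma beads_le:
  "y \<in> beads xs c \<Longrightarrow> (\<And>z. z \<in> set xs \<Longrightarrow> z \<le> x) \<Longrightarrow> y \<le> int x - 1 + c"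
proof (induction xs arbitrary: c)
  case (Cons a xs)
  show ?case
  proof (cases "y = int a - 1 + c")
    case False
    then show ?thesis
      using Cons.IH[of "c - 1"] Cons.prems by force
  qed (use Cons.prems(2)[of a] in auto)
qed auto

lemma beads_Cons_less:
  assumes "sorted_wrt (\<ge>) (x # xs)" "y \<in> beads xs (c - 1)"
  shows "y < int x - 1 + c"
  using beads_le[OF assms(2), of x] assms(1) by auto

lemma energy_beads:
  assumes "sorted_wrt (\<ge>) xs"
  shows "maya (beads xs c) \<and> energy m k (beads xs c) = m * int (sum_list xs) + (k * c + m * tri c)"
  using assms
proof (induction xs arbitrary: c)
  case Nil
  then show ?case
    by (simp add: maya_lessThan energy_lessThan)
next
  case (Cons x xs)
  have "int x - 1 + c \<notin> beads xs (c - 1)"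
    using beads_Cons_less[OF Cons.prems] by blast
  moreover have "maya (beads xs (c - 1))"
    "energy m k (beads xs (c - 1)) = m * int (sum_list xs) + (k * (c - 1) + m * tri (c - 1))"
    using Cons by auto
  moreover have "tri c = tri (c - 1) + (c - 1)"
    using tri_step[of "c - 1"] by simp
  ultimately show ?case
    using maya_insert(1)[of "beads xs (c - 1)" "int x - 1 + c"]
      maya_insert(2)[of "beads xs (c - 1)" "int x - 1 + c" m k] by (simp add: ring_distribs)
qed

lemma part_lists_Cons: "x # xs \<in> part_lists \<longleftrightarrow> 0 < x \<and> (\<forall>y\<in>set xs. y \<le> x) \<and> xs \<in> part_lists"
  by (auto simp: part_lists_def)

text \<open>The largest bead returns the first part, and removing it leaves the beads of the tail at
  charge \<open>c - 1\<close>. An empty list cannot share its beads with a nonempty one, since a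
  positive part puts a bead at or above \<open>c\<close>.\<close>

lemma beads_inj:
  "xs \<in> part_lists \<Longrightarrow> ys \<in> part_lists \<Longrightarrow> beads xs c = beads ys c \<Longrightarrow> xs = ys"
proof (induction xs arbitrary: ys c)
  case Nil
  show ?case
  proof (cases ys)
    case (Cons y zs)
    have "int y - 1 + c \<in> beads [] c"
      using Nil.prems(3) unfolding Cons by auto
    then show ?thesis
      using Nil.prems(2) unfolding Cons by (simp add: part_lists_Cons)
  qed simp
next
  case (Cons x xs)
  have srt: "sorted_wrt (\<ge>) (x # xs)"
    using Cons.prems by (simp add: part_lists_def)
  show ?case
  proof (cases ys)
    case Nil
    have "int x - 1 + c \<in> beads (x # xs) c"
      by simp
    then have "int x - 1 + c \<in> beads [] c"
      unfolding Cons.prems(3) Nil .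
    then show ?thesis
      using Cons.prems(1) by (simp add: part_lists_Cons)
  next
    case ys: (Cons y zs)
    have srt': "sorted_wrt (\<ge>) (y # zs)"
      using Cons.prems ys by (simp add: part_lists_def)
    have eq: "insert (int x - 1 + c) (beads xs (c - 1)) = insert (int y - 1 + c) (beads zs (c - 1))"
      using Cons.prems(3) ys by simp
    note l1 = beads_Cons_less[OF srt, of _ c] and l2 = beads_Cons_less[OF srt', of _ c]
    have "int x - 1 + c \<in> insert (int y - 1 + c) (beads zs (c - 1))"
      "int y - 1 + c \<in> insert (int x - 1 + c) (beads xs (c - 1))"
      using eq by blast+
    then have "x = y"
      using l1[of "int y - 1 + c"] l2[of "int x - 1 + c"] by auto
    moreover have "beads xs (c - 1) = beads zs (c - 1)"
      using eq l1[of "int y - 1 + c"] l2[of "int y - 1 + c"] \<open>x = y\<close>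
        insert_ident[of "int y - 1 + c" "beads xs (c - 1)" "beads zs (c - 1)"] by auto
    ultimately show ?thesis
      using Cons.IH[of zs "c - 1"] Cons.prems ys by (simp add: part_lists_Cons)
  qed
qed

text \<open>Induction on the number of beads that have a gap below them, which is the number of
  parts. The largest bead \<open>s\<close> yields the first part \<open>s + 1 - c\<close>, and what
  is left has charge \<open>c - 1\<close>.\<close>

lemma beads_surj:
  assumes "maya S"
  shows "\<exists>xs\<in>part_lists. S = beads xs (energy 0 1 S)"
  using assms
proof (induction "card {x \<in> S. \<exists>g<x. g \<notin> S}" arbitrary: S rule: less_induct)
  case less
  show ?case
  proof (cases "\<forall>x\<in>S. x - 1 \<in> S")
    case True
    then have "S = beads [] (energy 0 1 S)"
      using maya_down_closed[OF less.prems] by simp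
    then show ?thesis
      by (intro bexI[of _ "[]"]) (auto simp: part_lists_def)
  next
    case False
    then obtain x where x: "x \<in> S" "x - 1 \<notin> S"
      by blast
    obtain s where s: "s \<in> S" "\<And>x. x \<in> S \<Longrightarrow> x \<le> s"
      using maya_max[OF less.prems] by blast
    define S' where "S' = S - {s}"
    have S: "S = insert s S'" "s \<notin> S'"
      using s by (auto simp: S'_def)
    have maya': "maya S'"
      unfolding S'_def using less.prems by (rule maya_remove)
    define c where "c = energy 0 1 S"
    have c: "energy 0 1 S' = c - 1"
      using maya_insert(2)[OF maya' S(2), of 0 1] S(1) by (simp add: c_def)
    obtain b where b: "{..<b} \<subseteq> S"
      using less.prems by (rule maya_bounded_below)
    have fin: "finite {x \<in> S. \<exists>g<x. g \<notin> S}"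
      by (rule finite_subset[of _ "{b..s}"]) (use b s(2) in force)+
    have sin: "s \<in> {x \<in> S. \<exists>g<x. g \<notin> S}"
      using s x by force
    have sub: "{x \<in> S'. \<exists>g<x. g \<notin> S'} \<subseteq> {x \<in> S. \<exists>g<x. g \<notin> S} - {s}"
    proof
      fix y assume y: "y \<in> {x \<in> S'. \<exists>g<x. g \<notin> S'}"
      then obtain g where g: "g < y" "g \<notin> S'"
        by blast
      moreover have "y < s"
        using y s(2)[of y] by (auto simp: S'_def)
      ultimately have "g \<notin> S"
        by (auto simp: S'_def)
      then show "y \<in> {x \<in> S. \<exists>g<x. g \<notin> S} - {s}"
        using g y by (auto simp: S'_def)
    qed
    have "card {x \<in> S'. \<exists>g<x. g \<notin> S'} < card {x \<in> S. \<exists>g<x. g \<notin> S}"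
      by (rule psubset_card_mono[OF fin]) (use sub sin in blast)
    from less.hyps[OF this maya'] obtain xs where xs: "xs \<in> part_lists" "S' = beads xs (c - 1)"
      unfolding c by blast
    have hd: "int z \<le> s + 1 - c \<and> 0 < s + 1 - c" if "xs = z # zs" for z zs
    proof -
      have "int z - 1 + (c - 1) \<in> S'"
        unfolding xs(2) that by simp
      then have "int z - 1 + (c - 1) < s"
        using S s(2)[of "int z - 1 + (c - 1)"] by (metis insertCI less_le)
      moreover have "z > 0"
        using xs(1) that by (simp add: part_lists_Cons)
      ultimately show ?thesis
        by simp
    qed
    \<comment> \<open>A first part 0 would turn \<open>S\<close> into the half-line
      \<open>{..<c}\<close>, which has no gap below a bead.\<close>
    have nil: "0 < s + 1 - c" if "xs = []"
    proof (rule ccontr)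
      assume "\<not> 0 < s + 1 - c"
      moreover have S'': "S' = {..<c - 1}"
        using xs(2) that by simp
      ultimately have "s = c - 1"
        using S(2) by auto
      then have "S = {..<c}"
        using S(1) S'' by auto
      then show False
        using x by auto
    qed
    have pos: "0 < s + 1 - c"
      using hd nil by (cases xs) auto
    have "nat (s + 1 - c) # xs \<in> part_lists"
    proof (cases xs)
      case (Cons z zs)
      have "y \<le> nat (s + 1 - c)" if "y \<in> set xs" for y
        using hd[OF Cons] xs(1) that unfolding Cons by (force simp: part_lists_Cons)
      then show ?thesis
        using pos xs(1) by (auto simp: part_lists_Cons)
    qed (use pos in \<open>auto simp: part_lists_def\<close>)
    moreover have "S = beads (nat (s + 1 - c) # xs) c"
      using pos S(1) xs(2) by simp
    ultimately show ?thesis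
      unfolding c_def by blast
  qed
qed

lemma charge_beads: "xs \<in> part_lists \<Longrightarrow> energy 0 1 (beads xs c) = c"
  using energy_beads[of xs c 0 1] by (simp add: part_lists_def)

lemma maya_beads: "xs \<in> part_lists \<Longrightarrow> maya (beads xs c)"
  using energy_beads[of xs c 0 1] by (simp add: part_lists_def)

text \<open>Partition and charge are independent coordinates on Maya diagrams. This is what splits
  their generating function into a partition series times a theta series.\<close>

lemma bij_betw_beads:
  "bij_betw (\<lambda>p. beads (fst p) (snd p)) (part_lists \<times> UNIV) {S. maya S}"
  unfolding bij_betw_def
proof
  show "inj_on (\<lambda>p. beads (fst p) (snd p)) (part_lists \<times> UNIV)"
  proof (rule inj_onI)
    fix p p' :: "nat list \<times> int"
    assume p: "p \<in> part_lists \<times> UNIV" "p' \<in> part_lists \<times> UNIV"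
      and eq: "beads (fst p) (snd p) = beads (fst p') (snd p')"
    have "snd p = snd p'"
      using p charge_beads eq by (metis mem_Times_iff)
    then show "p = p'"
      using p eq beads_inj[of "fst p" "fst p'" "snd p"] by (auto simp: mem_Times_iff prod_eq_iff)
  qed
  show "(\<lambda>p. beads (fst p) (snd p)) ` (part_lists \<times> UNIV) = {S. maya S}"
    using beads_surj maya_beads by (fastforce simp: image_iff)
qed

lemma rev_sorted_part_list:
  assumes "xs \<in> part_lists"
  shows "rev (sorted_list_of_multiset (mset xs)) = xs"
proof -
  have "sorted (rev xs)"
    using assms by (simp add: part_lists_def sorted_wrt_rev)
  then have "sort xs = rev xs"
    by (simp add: properties_for_sort)
  then show ?thesis
    by simp
qed

lemma bij_betw_mset: "bij_betw mset part_lists {\<pi>. is_partition \<pi>}"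
proof (rule bij_betwI[of _ _ _ "\<lambda>\<pi>. rev (sorted_list_of_multiset \<pi>)"])
  show "mset \<in> part_lists \<rightarrow> {\<pi>. is_partition \<pi>}"
    by (auto simp: part_lists_def is_partition_def)
  show "(\<lambda>\<pi>. rev (sorted_list_of_multiset \<pi>)) \<in> {\<pi>. is_partition \<pi>} \<rightarrow> part_lists"
    by (auto simp: part_lists_def is_partition_def sorted_wrt_rev)
qed (simp_all add: rev_sorted_part_list del: sorted_list_of_multiset_mset)

section \<open>The Jacobi triple product\<close>

text \<open>Without positivity the class of 0 would contain 0 and bring in the vanishing factor
  \<open>1 - fps_X ^ 0\<close>.\<close>

definition residue_class :: "nat \<Rightarrow> nat \<Rightarrow> nat set" where
  "residue_class m k = {n. 0 < n \<and> n mod m = k}"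

definition sign :: "int \<Rightarrow> int" where
  "sign c = (if even c then 1 else - 1)"

text \<open>The exponent is \<open>energy (int m) (int k) {..<c}\<close>, the least energy among the
  diagrams of charge \<open>c\<close>.\<close>

definition theta :: "nat \<Rightarrow> nat \<Rightarrow> int fps" where
  "theta m k = gf UNIV sign (\<lambda>c. int k * c + int m * tri c)"

lemma tri_nonneg: "0 \<le> tri c"
proof -
  have "0 \<le> c * (c - 1)"
    by (cases "c \<ge> 1") (auto intro: mult_nonneg_nonneg mult_nonpos_nonpos)
  then show ?thesis
    using two_tri[of c] by linarith
qed

lemma tri_ge_minus: "- c \<le> tri c"
proof (cases "c < 0")
  case True
  have "2 * tri c + 2 * c = c * (c + 1)"
    using two_tri[of c] by (simp add: algebra_simps)
  moreover have "0 \<le> c * (c + 1)"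
    using True by (simp add: mult_nonpos_nonpos)
  ultimately show ?thesis
    by linarith
qed (use tri_nonneg[of c] in linarith)

text \<open>Linear growth makes the fibres finite. For \<open>c \<ge> 0\<close> it comes from
  \<open>k \<ge> 1\<close>; for \<open>c < 0\<close> the bound \<open>tri c \<ge> - c\<close>
  reduces it to \<open>m - k \<ge> 1\<close>.\<close>

lemma theta_weight_ge:
  assumes "0 < k" "k < m"
  shows "\<bar>c\<bar> \<le> int k * c + int m * tri c"
proof (cases "c \<ge> 0")
  case True
  have "1 * c \<le> int k * c"
    using assms True by (intro mult_right_mono) auto
  then show ?thesis
    using True tri_nonneg[of c] mult_nonneg_nonneg[of "int m" "tri c"] by linarith
next
  case False
  have "int m * (- c) \<le> int m * tri c"
    using tri_ge_minus by (intro mult_left_mono) auto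
  moreover have "1 * (- c) \<le> (int m - int k) * (- c)"
    using assms False by (intro mult_right_mono) auto
  ultimately show ?thesis
    using False by (simp add: algebra_simps)
qed

lemma graded_theta:
  assumes "0 < k" "k < m"
  shows "graded UNIV (\<lambda>c. int k * c + int m * tri c)"
proof (rule gradedI)
  show "0 \<le> int k * c + int m * tri c" for c
    using theta_weight_ge[OF assms, of c] by linarith
  show "finite {c. c \<in> UNIV \<and> int k * c + int m * tri c = int n}" for n
  proof (rule finite_subset)
    show "{c. c \<in> UNIV \<and> int k * c + int m * tri c = int n} \<subseteq> {- int n..int n}"
    proof
      fix c assume "c \<in> {c. c \<in> UNIV \<and> int k * c + int m * tri c = int n}"
      then show "c \<in> {- int n..int n}"
        using theta_weight_ge[OF assms, of c] by (simp add: abs_le_iff)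
    qed
  qed simp
qed

lemma is_partition_iff: "is_partition \<pi> \<longleftrightarrow> set_mset \<pi> \<subseteq> {1..}"
  by (auto simp: is_partition_def Suc_le_eq intro: gr0I)

lemma gf_part_lists: "gf part_lists (\<lambda>_. 1) (\<lambda>xs. int (sum_list xs)) = part_gf {1..}"
  unfolding part_gf_def
  by (rule gf_reindex[of mset])
    (use bij_betw_mset in \<open>auto simp: is_partition_iff sum_mset_sum_list\<close>)

lemma graded_part_lists: "graded part_lists (\<lambda>xs. int (sum_list xs))"
proof (rule graded_inj[of mset])
  show "graded {\<pi>. set_mset \<pi> \<subseteq> {1..}} (\<lambda>\<pi>. int (\<Sum>\<^sub># \<pi>))"
    by (rule graded_partitions) simp
  show "inj_on mset part_lists"
    using bij_betw_mset by (rule bij_betw_imp_inj_on)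
qed (auto simp: part_lists_def sum_mset_sum_list Suc_le_eq intro: gr0I)

lemma graded_Fpow_image:
  assumes "inj_on f I"
  shows "graded (Fpow I) (\<lambda>A. int (\<Sum>x\<in>A. f x))"
proof (rule graded_inj[of "image f", OF inj_on_image_Fpow[OF assms] _ _ graded_Fpow[of "f ` I"]])
  show "int (\<Sum>(f ` A)) = int (\<Sum>x\<in>A. f x)" if "A \<in> Fpow I" for A
    using assms that by (subst sum.reindex) (auto simp: Fpow_def intro: inj_on_subset)
qed (auto simp: Fpow_def)

text \<open>Beads at \<open>x \<ge> 0\<close> and holes at \<open>x < 0\<close> are chosen
  independently. Their energies \<open>k + m * x\<close> and \<open>- (k + m * x)\<close> run
  through the two residue classes, and each bead or hole changes the parity of the charge, hence the
  sign.\<close>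

lemma gf_maya:
  assumes "0 < k" "k < m"
  shows "gf {S. maya S} (\<lambda>S. sign (energy 0 1 S)) (energy (int m) (int k)) =
    euler (residue_class m k) * euler (residue_class m (m - k))"
proof -
  define f g where "f = (\<lambda>x. nat (int k + int m * x))" and "g = (\<lambda>x. nat (- (int k + int m * x)))"
  have f: "int (f x) = int k + int m * x" if "x \<ge> 0" for x
    using that by (simp add: f_def)
  have g: "int (g x) = - (int k + int m * x)" if "x < 0" for x
  proof -
    have "int m * x \<le> int m * (- 1)"
      using that by (intro mult_left_mono) auto
    then show ?thesis
      using assms by (simp add: g_def)
  qed
  have inj: "inj_on f {0..}" "inj_on g {..<0}"
    using assms f g by (auto intro!: inj_onI dest!: arg_cong[of _ _ int])
  have im_f: "f ` {0..} = residue_class m k"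
  proof (intro equalityI subsetI)
    fix n assume "n \<in> f ` {0..}"
    then obtain x where x: "x \<ge> 0" "n = f x"
      by auto
    then have "int n = int (k + m * nat x)"
      using f[of x] by simp
    then have "n = k + m * nat x"
      by (simp only: of_nat_eq_iff)
    then show "n \<in> residue_class m k"
      using assms by (simp add: residue_class_def)
  next
    fix n assume "n \<in> residue_class m k"
    then have "n = k + m * (n div m)"
      by (auto simp: residue_class_def)
    then have "int n = int k + int m * int (n div m)"
      by (metis of_nat_add of_nat_mult)
    then have "n = f (int (n div m))"
      using f[of "int (n div m)"] by linarith
    then show "n \<in> f ` {0..}"
      by auto
  qed
  have im_g: "g ` {..<0} = residue_class m (m - k)"
  proof (intro equalityI subsetI)
    fix n assume "n \<in> g ` {..<0}"
    then obtain x where x: "x < 0" "n = g x"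
      by auto
    then have "int n = int ((m - k) + m * nat (- x - 1))"
      using g[of x] assms by (simp add: of_nat_diff algebra_simps)
    then have "n = (m - k) + m * nat (- x - 1)"
      by (simp only: of_nat_eq_iff)
    then have "n mod m = (m - k) mod m" "n \<ge> m - k"
      by (simp_all only: mod_mult_self2 le_add1)
    then show "n \<in> residue_class m (m - k)"
      using assms by (simp add: residue_class_def)
  next
    fix n assume "n \<in> residue_class m (m - k)"
    then have "n mod m = m - k"
      by (simp add: residue_class_def)
    moreover have "int n = int (m * (n div m) + n mod m)"
      by simp
    ultimately have "int n = (int m - int k) + int m * int (n div m)"
      using assms unfolding of_nat_add of_nat_mult by (simp add: of_nat_diff)
    then have "n = g (- int (n div m) - 1)"
      using g[of "- int (n div m) - 1"] by (simp add: algebra_simps del: of_nat_div)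
    then show "n \<in> g ` {..<0}"
      by auto
  qed
  have split: "(A \<union> ({..<0} - B)) \<inter> {0..} = A \<and> {..<0} - (A \<union> ({..<0} - B)) = B"
    if "A \<in> Fpow {0..}" "B \<in> Fpow {..<0}" for A B :: "int set"
    using that by (fastforce simp: Fpow_def)
  have bij: "bij_betw (\<lambda>S. (S \<inter> {0..}, {..<0} - S)) {S. maya S} (Fpow {0..} \<times> Fpow {..<0})"
  proof (rule bij_betwI[of _ _ _ "\<lambda>(A, B). A \<union> ({..<0} - B)"])
    show "(\<lambda>(A, B). A \<union> ({..<0} - B)) \<in> Fpow {0..} \<times> Fpow {..<0} \<rightarrow> {S. maya S}"
    proof clarify
      fix A B :: "int set" assume "A \<in> Fpow {0..}" "B \<in> Fpow {..<0}"
      then show "maya (A \<union> ({..<0} - B))"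
        using split[of A B] by (simp add: maya_def Fpow_def)
    qed
    show "(\<lambda>S. (S \<inter> {0..}, {..<0} - S)) \<in> {S. maya S} \<rightarrow> Fpow {0..} \<times> Fpow {..<0}"
      by (auto simp: maya_def Fpow_def)
    show "(case (S \<inter> {0..}, {..<0} - S) of (A, B) \<Rightarrow> A \<union> ({..<0} - B)) = S" if "S \<in> {S. maya S}" for S
      by auto
    show "((case p of (A, B) \<Rightarrow> A \<union> ({..<0} - B)) \<inter> {0..}, {..<0} - (case p of (A, B) \<Rightarrow> A \<union> ({..<0} - B))) = p"
      if "p \<in> Fpow {0..} \<times> Fpow {..<0}" for p :: "int set \<times> int set"
      using that split[of "fst p" "snd p"] by (cases p) simp
  qed
  have "euler (residue_class m k) * euler (residue_class m (m - k)) =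
    gf (Fpow {0..} \<times> Fpow {..<0}) (\<lambda>p. (- 1) ^ card (fst p) * (- 1) ^ card (snd p))
      (\<lambda>p. int (\<Sum>x\<in>fst p. f x) + int (\<Sum>x\<in>snd p. g x))"
    unfolding im_f[symmetric] im_g[symmetric] euler_image[OF inj(1), symmetric] euler_image[OF inj(2), symmetric]
    by (rule gf_times[OF graded_Fpow_image[OF inj(1)] graded_Fpow_image[OF inj(2)]])
  also have "\<dots> = gf {S. maya S} (\<lambda>S. sign (energy 0 1 S)) (energy (int m) (int k))"
  proof (rule gf_reindex[OF bij, symmetric])
    fix S assume "S \<in> {S. maya S}"
    have "energy 0 1 S = int (card (S \<inter> {0..})) - int (card ({..<0} - S))"
      by (simp add: energy_def)
    then show "(- 1) ^ card (fst (S \<inter> {0..}, {..<0} - S)) * (- 1) ^ card (snd (S \<inter> {0..}, {..<0} - S)) =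
        sign (energy 0 1 S)"
      by (auto simp: sign_def minus_one_power_iff)
    have "int (\<Sum>x\<in>S \<inter> {0..}. f x) = (\<Sum>x\<in>S \<inter> {0..}. int k + int m * x)"
      unfolding of_nat_sum by (rule sum.cong) (use f in auto)
    moreover have "int (\<Sum>x\<in>{..<0} - S. g x) = - (\<Sum>x\<in>{..<0} - S. int k + int m * x)"
      unfolding of_nat_sum sum_negf[symmetric] by (rule sum.cong) (use g in auto)
    ultimately show "int (sum f (fst (S \<inter> {0..}, {..<0} - S))) + int (sum g (snd (S \<inter> {0..}, {..<0} - S))) =
        energy (int m) (int k) S"
      by (simp add: energy_def)
  qed
  finally show ?thesis ..
qed

lemma residue_class_0: "m > 0 \<Longrightarrow> residue_class m 0 = (*) m ` {1..}"
  by (auto simp: residue_class_def image_iff Suc_le_eq elim!: dvdE)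

text \<open>\<open>gf_maya\<close> counts the diagrams by beads and holes; counted by partition and
  charge, a partition adds \<open>m\<close> times its size to the energy, whence the substitution X
  -> X^m in the partition series. Its inverse becomes the factor of the class of 0.\<close>

theorem jacobi_triple_product:
  assumes "0 < k" "k < m"
  shows "theta m k = euler (residue_class m k) * euler (residue_class m (m - k)) * euler (residue_class m 0)"
proof -
  let ?p = "part_gf {1..} oo fps_X ^ m"
  have "gf {S. maya S} (\<lambda>S. sign (energy 0 1 S)) (energy (int m) (int k)) =
    gf (part_lists \<times> UNIV) (\<lambda>p. 1 * sign (snd p))
      (\<lambda>p. int m * int (sum_list (fst p)) + (int k * snd p + int m * tri (snd p)))"
    by (rule gf_reindex[OF bij_betw_beads, symmetric])
      (auto simp: charge_beads energy_beads part_lists_def)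
  also have "\<dots> = ?p * theta m k"
    unfolding theta_def using assms gf_scale[OF graded_part_lists, of m "\<lambda>_. 1"]
    by (subst gf_times[symmetric]) (auto simp: gf_part_lists graded_theta intro: graded_scale graded_part_lists)
  finally have "?p * theta m k = euler (residue_class m k) * euler (residue_class m (m - k))"
    using gf_maya[OF assms] by simp
  then have "(euler {1..} oo fps_X ^ m) * ?p * theta m k =
      euler (residue_class m k) * euler (residue_class m (m - k)) * (euler {1..} oo fps_X ^ m)"
    by (simp add: mult_ac)
  moreover have "(euler {1..} oo fps_X ^ m) * ?p = 1"
    using assms euler_part_gf[of "{1..}"] fps_compose_mult_distrib[of "fps_X ^ m" "euler {1..}" "part_gf {1..}"]
    by simp
  ultimately show ?thesis
    using assms by (simp only: euler_scale residue_class_0 mult_1_left)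
qed

section \<open>Cores\<close>

lemma mem_beads:
  "x \<in> beads xs c \<longleftrightarrow> (\<exists>i<length xs. x = int (xs ! i) - int i - 1 + c) \<or> x < c - int (length xs)"
proof (induction xs arbitrary: c)
  case (Cons a xs)
  have "(\<exists>i<length (a # xs). x = int ((a # xs) ! i) - int i - 1 + c) \<longleftrightarrow>
      x = int a - 1 + c \<or> (\<exists>i<length xs. x = int (xs ! i) - int i - 1 + (c - 1))"
    unfolding length_Cons Ex_less_Suc2 by (simp add: algebra_simps)
  then show ?case
    using Cons.IH[of "c - 1"] by (simp add: algebra_simps)
qed simp

section \<open>Hook lengths on the abacus\<close>

definition col_length :: "nat list \<Rightarrow> nat \<Rightarrow> nat" where
  "col_length xs j = card {i. i < length xs \<and> j < xs ! i}"

lemma less_card_down_closed: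
  fixes D :: "nat set"
  assumes "finite D" "\<And>i i'. i \<in> D \<Longrightarrow> i' < i \<Longrightarrow> i' \<in> D"
  shows "i \<in> D \<longleftrightarrow> i < card D"
proof -
  define n where "n = (LEAST n. n \<notin> D)"
  have "\<exists>n. n \<notin> D"
    using assms(1) infinite_UNIV_nat by (metis UNIV_eq_I)
  then have n: "n \<notin> D"
    unfolding n_def by (rule LeastI_ex)
  have "D = {..<n}"
  proof (intro equalityI subsetI)
    show "x \<in> {..<n}" if "x \<in> D" for x
      using that n assms(2)[of x n] by (cases x n rule: linorder_cases) auto
    show "x \<in> D" if "x \<in> {..<n}" for x
      using that not_less_Least[of x "\<lambda>n. n \<notin> D"] by (auto simp: n_def)
  qed
  then show ?thesis
    by simp
qed

lemma part_lists_nth_mono: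
  assumes "xs \<in> part_lists" "i \<le> i'" "i' < length xs"
  shows "xs ! i' \<le> xs ! i"
  using assms sorted_wrt_nth_less[of "(\<ge>)" xs i i'] by (cases "i = i'") (auto simp: part_lists_def)

lemma less_col_length:
  assumes "xs \<in> part_lists"
  shows "i < col_length xs j \<longleftrightarrow> i < length xs \<and> j < xs ! i"
proof -
  have "i \<in> {i. i < length xs \<and> j < xs ! i} \<longleftrightarrow> i < card {i. i < length xs \<and> j < xs ! i}"
  proof (rule less_card_down_closed)
    show "i' \<in> {i. i < length xs \<and> j < xs ! i}" if "i \<in> {i. i < length xs \<and> j < xs ! i}" "i' < i" for i i'
      using part_lists_nth_mono[OF assms, of i' i] that by auto
  qed simp
  then show ?thesis
    by (simp add: col_length_def)
qed

lemma ferrers_mset: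
  assumes "xs \<in> part_lists"
  shows "ferrers (mset xs) = {(i, j). i < length xs \<and> j < xs ! i}"
  unfolding ferrers_def rev_sorted_part_list[OF assms] by simp

text \<open>The cell and its arm give \<open>xs ! i - j\<close>, the leg gives
  \<open>col_length xs j - Suc i\<close>. Regrouped, a term of row \<open>i\<close> (its bead at
  charge 0) minus a term of column \<open>j\<close>.\<close>

lemma card_hook:
  assumes "xs \<in> part_lists" "i < length xs" "j < xs ! i"
  shows "int (card (hook (mset xs) (i, j))) = (int (xs ! i) - int i - 1) - (int j - int (col_length xs j))"
proof -
  have i: "i < col_length xs j"
    using assms by (simp add: less_col_length)
  have "hook (mset xs) (i, j) = {i} \<times> {j..<xs ! i} \<union> {i<..<col_length xs j} \<times> {j}"
    unfolding hook_def ferrers_mset[OF assms(1)]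
    using assms by (auto simp: less_col_length[OF assms(1)])
  moreover have "({i} \<times> {j..<xs ! i}) \<inter> ({i<..<col_length xs j} \<times> {j}) = {}"
    by auto
  ultimately have "card (hook (mset xs) (i, j)) = (xs ! i - j) + (col_length xs j - Suc i)"
    by (simp add: card_Un_disjoint card_cartesian_product)
  then show ?thesis
    using assms i by (simp add: of_nat_diff)
qed

text \<open>Beads are indexed by the rows and gaps by the columns; a hook length is the distance from a bead
  down to a gap.\<close>

lemma col_not_in_beads:
  assumes "xs \<in> part_lists"
  shows "int j - int (col_length xs j) \<notin> beads xs 0"
proof
  assume "int j - int (col_length xs j) \<in> beads xs 0"
  then consider i where "i < length xs" "int j - int (col_length xs j) = int (xs ! i) - int i - 1"
    | "int j - int (col_length xs j) < - int (length xs)"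
    by (auto simp: mem_beads)
  then show False
  proof cases
    case 1
    then show False
      using less_col_length[OF assms, of i j] by (cases "i < col_length xs j") auto
  next
    case 2
    then have "length xs < col_length xs j"
      by linarith
    then show False
      using less_col_length[OF assms, of "length xs" j] by simp
  qed
qed

text \<open>If exactly \<open>i\<close> beads lie above the gap \<open>x\<close>, then column
  \<open>x + i\<close> has length \<open>i\<close>, so the gap belongs to that column.\<close>

lemma not_in_beads_col:
  assumes "xs \<in> part_lists" "x \<notin> beads xs 0"
  obtains j where "x = int j - int (col_length xs j)"
proof -
  let ?P = "\<lambda>i. i \<ge> length xs \<or> int (xs ! i) - int i - 1 < x"
  define i where "i = (LEAST i. ?P i)"
  have Pi: "?P i"
    unfolding i_def by (rule LeastI[of ?P "length xs"]) simp
  have less: "\<not> ?P i'" if "i' < i" for i'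
    using that unfolding i_def by (rule not_less_Least)
  have len: "i \<le> length xs"
    unfolding i_def by (rule Least_le) simp
  have x: "- int (length xs) \<le> x" "\<And>i. i < length xs \<Longrightarrow> x \<noteq> int (xs ! i) - int i - 1"
    using assms(2) by (auto simp: mem_beads)
  have j: "x + int i \<ge> 0"
    using Pi x(1) len by (cases "i = length xs") auto
  define j where "j = nat (x + int i)"
  have "i' < col_length xs j \<longleftrightarrow> i' < i" for i'
    unfolding less_col_length[OF assms(1)]
  proof
    assume i': "i' < length xs \<and> j < xs ! i'"
    show "i' < i"
    proof (rule ccontr)
      assume "\<not> i' < i"
      then have "xs ! i' \<le> xs ! i" "i < length xs"
        using i' part_lists_nth_mono[OF assms(1), of i i'] by auto
      then show False
        using Pi i' j by (auto simp: j_def)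
    qed
  next
    assume i': "i' < i"
    then have "xs ! (i - 1) \<le> xs ! i'" "i - 1 < length xs"
      using len part_lists_nth_mono[OF assms(1), of i' "i - 1"] by auto
    moreover have "int (xs ! (i - 1)) - int (i - 1) - 1 > x"
      using less[of "i - 1"] i' x(2)[of "i - 1"] len by auto
    ultimately show "i' < length xs \<and> j < xs ! i'"
      using i' len j by (auto simp: j_def)
  qed
  then have "col_length xs j = i"
    by (metis less_irrefl linorder_neqE_nat)
  then show ?thesis
    using j by (intro that[of j]) (simp add: j_def)
qed

text \<open>A bead \<open>x\<close> with a gap at \<open>x - t\<close> produces a hook of length
  exactly \<open>t\<close>. Conversely, a hook of length \<open>t * n\<close> joins a bead to a gap,
  and \<open>n\<close> applications of closure would put a bead into that gap.\<close>

theorem cores_iff_beads: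
  assumes "xs \<in> part_lists"
  shows "mset xs \<in> cores t \<longleftrightarrow> (\<forall>x\<in>beads xs 0. x - int t \<in> beads xs 0)"
proof
  assume core: "mset xs \<in> cores t"
  show "\<forall>x\<in>beads xs 0. x - int t \<in> beads xs 0"
  proof (rule ballI, rule ccontr)
    fix x assume x: "x \<in> beads xs 0" "x - int t \<notin> beads xs 0"
    then obtain i where i: "i < length xs" "x = int (xs ! i) - int i - 1"
      by (auto simp: mem_beads)
    obtain j where j: "x - int t = int j - int (col_length xs j)"
      using not_in_beads_col[OF assms x(2)] by blast
    have "j < xs ! i"
      using less_col_length[OF assms, of i j] i j by linarith
    then have "int (card (hook (mset xs) (i, j))) = int t" "(i, j) \<in> ferrers (mset xs)"
      using card_hook[OF assms i(1)] i j ferrers_mset[OF assms] by auto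
    then show False
      using core by (auto simp: cores_def)
  qed
next
  assume closed: "\<forall>x\<in>beads xs 0. x - int t \<in> beads xs 0"
  have iter: "x - int t * int n \<in> beads xs 0" if "x \<in> beads xs 0" for x n
  proof (induction n)
    case (Suc n)
    then show ?case
      using closed[rule_format, of "x - int t * int n"] by (simp add: algebra_simps)
  qed (use that in simp)
  have "\<not> t dvd card (hook (mset xs) (i, j))" if ij: "i < length xs" "j < xs ! i" for i j
  proof
    assume "t dvd card (hook (mset xs) (i, j))"
    then obtain n where n: "card (hook (mset xs) (i, j)) = t * n" ..
    have "int (xs ! i) - int i - 1 \<in> beads xs 0"
      using ij by (auto simp: mem_beads)
    from iter[OF this, of n] have "int j - int (col_length xs j) \<in> beads xs 0"
      using card_hook[OF assms ij] n by simp
    then show False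
      using col_not_in_beads[OF assms] by blast
  qed
  moreover have "is_partition (mset xs)"
    using assms by (simp add: part_lists_def is_partition_def)
  ultimately show "mset xs \<in> cores t"
    by (auto simp: cores_def ferrers_mset[OF assms])
qed

section \<open>Runners, cores and quotients\<close>

definition runner :: "nat \<Rightarrow> int set \<Rightarrow> nat \<Rightarrow> int set" where
  "runner t S r = {x. int t * x + int r \<in> S}"

definition interleave :: "nat \<Rightarrow> (nat \<Rightarrow> int set) \<Rightarrow> int set" where
  "interleave t F = {y. y div int t \<in> F (nat (y mod int t))}"

lemma runner_interleave: "r < t \<Longrightarrow> runner t (interleave t F) r = F r"
  by (simp add: runner_def interleave_def)

lemma interleave_runner: "t > 0 \<Longrightarrow> interleave t (runner t S) = S"
  by (simp add: runner_def interleave_def)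

lemma interleave_cong: "t > 0 \<Longrightarrow> (\<And>r. r < t \<Longrightarrow> F r = G r) \<Longrightarrow> interleave t F = interleave t G"
  by (simp add: interleave_def nat_less_iff)

lemma maya_runner:
  assumes "maya S" "r < t"
  shows "maya (runner t S r)"
proof -
  let ?f = "\<lambda>x. int t * x + int r"
  have inj: "inj_on ?f A" for A
    using assms by (auto simp: inj_on_def)
  have neg: "int t * x + int r < 0" if "x < 0" for x
  proof -
    have "int t * x \<le> int t * (- 1)"
      using that by (intro mult_left_mono) auto
    then show ?thesis
      using assms(2) by linarith
  qed
  have "?f ` (runner t S r \<inter> {0..}) \<subseteq> S \<inter> {0..}" "?f ` ({..<0} - runner t S r) \<subseteq> {..<0} - S"
    using neg by (auto simp: runner_def)
  then show ?thesis
    using assms(1) inj unfolding maya_def by (meson finite_imageD finite_subset)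
qed

lemma sum_interleave:
  assumes "t > 0" "\<And>r. r < t \<Longrightarrow> finite (G r)"
  shows "finite (\<Union>r<t. (\<lambda>x. int t * x + int r) ` G r)"
    and "sum h (\<Union>r<t. (\<lambda>x. int t * x + int r) ` G r) = (\<Sum>r<t. \<Sum>x\<in>G r. h (int t * x + int r))"
proof -
  show "finite (\<Union>r<t. (\<lambda>x. int t * x + int r) ` G r)"
    using assms by auto
  have disj: "(\<lambda>x. int t * x + int r) ` G r \<inter> (\<lambda>x. int t * x + int s) ` G s = {}"
    if "r < t" "s < t" "r \<noteq> s" for r s
  proof -
    have "int t * x + int r \<noteq> int t * y + int s" for x y
    proof
      assume "int t * x + int r = int t * y + int s"
      then have "(int t * x + int r) mod int t = (int t * y + int s) mod int t"
        by simp
      then show False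
        using that by simp
    qed
    then show ?thesis
      by auto
  qed
  have "sum h (\<Union>r<t. (\<lambda>x. int t * x + int r) ` G r) = (\<Sum>r<t. sum h ((\<lambda>x. int t * x + int r) ` G r))"
    by (rule sum.UNION_disjoint) (use assms disj in auto)
  also have "\<dots> = (\<Sum>r<t. \<Sum>x\<in>G r. h (int t * x + int r))"
    by (rule sum.cong[OF refl], subst sum.reindex) (use assms(1) in \<open>auto simp: inj_on_def\<close>)
  finally show "sum h (\<Union>r<t. (\<lambda>x. int t * x + int r) ` G r) = \<dots>" .
qed

text \<open>Place \<open>x\<close> of runner \<open>r\<close> is the integer t x + r, and k + m (t x
  + r) = (k + m r) + (m t) x. So the energy of a runner is an energy with new parameters, which is
  why \<open>energy\<close> carries both \<open>m\<close> and \<open>k\<close>.\<close>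

lemma energy_interleave:
  assumes "t > 0" "\<And>r. r < t \<Longrightarrow> maya (F r)"
  shows "maya (interleave t F)"
    and "energy m k (interleave t F) = (\<Sum>r<t. energy (m * int t) (k + m * int r) (F r))"
proof -
  have pos: "interleave t F \<inter> {0..} = (\<Union>r<t. (\<lambda>x. int t * x + int r) ` (F r \<inter> {0..}))" (is "_ = ?U")
  proof (intro equalityI subsetI)
    fix y assume "y \<in> interleave t F \<inter> {0..}"
    then show "y \<in> ?U"
      using assms(1) by (auto simp: interleave_def nat_less_iff pos_imp_zdiv_nonneg_iff
          intro!: bexI[of _ "nat (y mod int t)"] image_eqI[of _ _ "y div int t"])
  qed (use assms(1) in \<open>auto simp: interleave_def\<close>)
  have neg: "{..<0} - interleave t F = (\<Union>r<t. (\<lambda>x. int t * x + int r) ` ({..<0} - F r))" (is "_ = ?V")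
  proof (intro equalityI subsetI)
    fix y assume "y \<in> {..<0} - interleave t F"
    then show "y \<in> ?V"
      using assms(1) by (auto simp: interleave_def nat_less_iff pos_imp_zdiv_neg_iff
          intro!: bexI[of _ "nat (y mod int t)"] image_eqI[of _ _ "y div int t"])
  next
    fix y assume "y \<in> ?V"
    then obtain r x where rx: "r < t" "x < 0" "x \<notin> F r" "y = int t * x + int r"
      by auto
    have "int t * x \<le> int t * (- 1)"
      using rx by (intro mult_left_mono) auto
    then show "y \<in> {..<0} - interleave t F"
      using rx by (auto simp: interleave_def)
  qed
  have fin: "\<And>r. r < t \<Longrightarrow> finite (F r \<inter> {0..})" "\<And>r. r < t \<Longrightarrow> finite ({..<0} - F r)"
    using assms(2) by (auto simp: maya_def)
  show "maya (interleave t F)"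
    unfolding maya_def pos neg using sum_interleave(1)[OF assms(1)] fin by auto
  show "energy m k (interleave t F) = (\<Sum>r<t. energy (m * int t) (k + m * int r) (F r))"
    using sum_interleave(2)[OF assms(1) fin(1), where h = "\<lambda>x. k + m * x"]
      sum_interleave(2)[OF assms(1) fin(2), where h = "\<lambda>x. k + m * x"]
    unfolding energy_def pos neg by (simp add: sum_subtractf distrib_left mult.assoc add.assoc add.commute)
qed

text \<open>A core is a Maya diagram whose runners are all of the form \<open>{..<c}\<close>, hence is determined by the
  vector of these charges.\<close>

definition charge_vectors :: "nat \<Rightarrow> (nat \<Rightarrow> int) set" where
  "charge_vectors t = {c \<in> PiE {..<t} (\<lambda>_. UNIV). (\<Sum>r<t. c r) = 0}"

text \<open>The size of the core with runner charges \<open>c\<close>. On vectors of sum 0 it is the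
  familiar form (t/2) |c|^2 plus the sum of all r c_r.\<close>

definition charge_weight :: "nat \<Rightarrow> (nat \<Rightarrow> int) \<Rightarrow> int" where
  "charge_weight t c = (\<Sum>r<t. int r * c r + int t * tri (c r))"

lemma energy_interleave_beads:
  assumes "t > 0" "\<And>r. r < t \<Longrightarrow> L r \<in> part_lists"
  shows "maya (interleave t (\<lambda>r. beads (L r) (c r)))"
    and "energy 0 1 (interleave t (\<lambda>r. beads (L r) (c r))) = (\<Sum>r<t. c r)"
    and "energy 1 0 (interleave t (\<lambda>r. beads (L r) (c r))) =
      charge_weight t c + (\<Sum>r<t. int t * int (sum_list (L r)))"
proof -
  have *: "sorted_wrt (\<ge>) (L r)" if "r < t" for r
    using assms(2)[OF that] by (simp add: part_lists_def)
  have maya: "maya (beads (L r) (c r))" if "r < t" for r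
    using energy_beads[OF *[OF that]] by simp
  have em: "maya (interleave t (\<lambda>r. beads (L r) (c r)))"
    "energy m k (interleave t (\<lambda>r. beads (L r) (c r))) =
      (\<Sum>r<t. energy (m * int t) (k + m * int r) (beads (L r) (c r)))" for m k
    using energy_interleave[OF assms(1), of "\<lambda>r. beads (L r) (c r)"] maya by auto
  show "maya (interleave t (\<lambda>r. beads (L r) (c r)))"
    by (rule em(1))
  show "energy 0 1 (interleave t (\<lambda>r. beads (L r) (c r))) = (\<Sum>r<t. c r)"
    unfolding em(2) by (intro sum.cong) (auto simp: energy_beads[OF *])
  have "energy 1 0 (interleave t (\<lambda>r. beads (L r) (c r))) =
      (\<Sum>r<t. (int r * c r + int t * tri (c r)) + int t * int (sum_list (L r)))"
    unfolding em(2) by (rule sum.cong) (auto simp: energy_beads[OF *])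
  then show "energy 1 0 (interleave t (\<lambda>r. beads (L r) (c r))) =
      charge_weight t c + (\<Sum>r<t. int t * int (sum_list (L r)))"
    by (simp add: charge_weight_def sum.distrib)
qed

lemma bij_betw_beads_0: "bij_betw (\<lambda>xs. beads xs 0) part_lists {S. maya S \<and> energy 0 1 S = 0}"
  unfolding bij_betw_def
proof
  show "inj_on (\<lambda>xs. beads xs 0) part_lists"
    using beads_inj by (auto intro: inj_onI)
  show "(\<lambda>xs. beads xs 0) ` part_lists = {S. maya S \<and> energy 0 1 S = 0}"
    using beads_surj maya_beads charge_beads by (fastforce simp: image_iff)
qed

lemma energy_beads_0: "xs \<in> part_lists \<Longrightarrow> energy 1 0 (beads xs 0) = int (sum_list xs)"
  using energy_beads[of xs 0 1 0] by (simp add: part_lists_def tri_def)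

text \<open>The decomposition of a partition into core and quotient: the runner charges describe the
  core, the \<open>t\<close> partitions on the runners form the quotient, and the vanishing sum is
  the total charge 0.\<close>

lemma bij_betw_quotient:
  assumes "t > 0"
  shows "bij_betw (\<lambda>p. interleave t (\<lambda>r. beads (snd p r) (fst p r)))
    (charge_vectors t \<times> PiE {..<t} (\<lambda>_. part_lists)) {S. maya S \<and> energy 0 1 S = 0}"
    (is "bij_betw ?f ?A ?B")
  unfolding bij_betw_def
proof
  show "inj_on ?f ?A"
  proof (rule inj_onI)
    fix p q assume p: "p \<in> ?A" and q: "q \<in> ?A" and eq: "?f p = ?f q"
    have *: "fst p r = fst q r \<and> snd p r = snd q r" if "r < t" for r
    proof -
      have L: "snd p r \<in> part_lists" "snd q r \<in> part_lists"
        using p q that PiE_mem[of _ "{..<t}" "\<lambda>_. part_lists" r] by (simp_all add: mem_Times_iff)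
      have "beads (snd p r) (fst p r) = beads (snd q r) (fst q r)"
        using arg_cong[OF eq, of "\<lambda>S. runner t S r"] that by (simp add: runner_interleave)
      then show ?thesis
        using inj_onD[OF bij_betw_imp_inj_on[OF bij_betw_beads], of "(snd p r, fst p r)" "(snd q r, fst q r)"] L
        by simp
    qed
    have "fst p = fst q"
      using p q * by (intro PiE_ext[of _ "{..<t}" "\<lambda>_. UNIV"]) (auto simp: charge_vectors_def)
    moreover have "snd p = snd q"
      using p q * by (intro PiE_ext[of _ "{..<t}" "\<lambda>_. part_lists"]) auto
    ultimately show "p = q"
      by (simp add: prod_eq_iff)
  qed
  show "?f ` ?A = ?B"
  proof (intro equalityI subsetI)
    fix S assume "S \<in> ?f ` ?A"
    then obtain c L where cL: "c \<in> charge_vectors t" "L \<in> PiE {..<t} (\<lambda>_. part_lists)"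
      "S = interleave t (\<lambda>r. beads (L r) (c r))"
      by auto
    have "L r \<in> part_lists" if "r < t" for r
      using PiE_mem[OF cL(2)] that by simp
    from energy_interleave_beads[OF assms, of L c, OF this] show "S \<in> ?B"
      using cL by (simp add: charge_vectors_def)
  next
    fix S assume S: "S \<in> ?B"
    have "\<exists>xs\<in>part_lists. runner t S r = beads xs (energy 0 1 (runner t S r))" if "r < t" for r
      using beads_surj[OF maya_runner] S that by blast
    then obtain L where L: "\<And>r. r < t \<Longrightarrow> L r \<in> part_lists"
      "\<And>r. r < t \<Longrightarrow> runner t S r = beads (L r) (energy 0 1 (runner t S r))"
      by metis
    define L' c where "L' = restrict L {..<t}" and "c = restrict (\<lambda>r. energy 0 1 (runner t S r)) {..<t}"
    have "S = interleave t (runner t S)"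
      using assms by (simp add: interleave_runner)
    also have "\<dots> = interleave t (\<lambda>r. beads (L' r) (c r))"
      using L(2) by (intro interleave_cong[OF assms]) (simp add: L'_def c_def)
    finally have SL: "S = interleave t (\<lambda>r. beads (L' r) (c r))" .
    have "(\<Sum>r<t. c r) = 0"
      using energy_interleave_beads(2)[OF assms, of L' c] S L(1) SL by (simp add: L'_def)
    then have "(c, L') \<in> ?A"
      using L(1) by (auto simp: charge_vectors_def c_def L'_def)
    then show "S \<in> ?f ` ?A"
      using SL by force
  qed
qed

lemma bij_betw_cores:
  "bij_betw (\<lambda>xs. beads xs 0) {xs \<in> part_lists. mset xs \<in> cores t}
    {S. maya S \<and> energy 0 1 S = 0 \<and> (\<forall>x\<in>S. x - int t \<in> S)}"
proof (rule bij_betw_subset[OF bij_betw_beads_0])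
  show "(\<lambda>xs. beads xs 0) ` {xs \<in> part_lists. mset xs \<in> cores t} =
      {S. maya S \<and> energy 0 1 S = 0 \<and> (\<forall>x\<in>S. x - int t \<in> S)}"
  proof (intro equalityI subsetI)
    fix S assume S: "S \<in> {S. maya S \<and> energy 0 1 S = 0 \<and> (\<forall>x\<in>S. x - int t \<in> S)}"
    then obtain xs where xs: "xs \<in> part_lists" "S = beads xs 0"
      using bij_betw_imp_surj_on[OF bij_betw_beads_0] by blast
    then have "mset xs \<in> cores t"
      using S cores_iff_beads by simp
    then show "S \<in> (\<lambda>xs. beads xs 0) ` {xs \<in> part_lists. mset xs \<in> cores t}"
      using xs by blast
  next
    fix S assume "S \<in> (\<lambda>xs. beads xs 0) ` {xs \<in> part_lists. mset xs \<in> cores t}"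
    then obtain xs where "xs \<in> part_lists" "mset xs \<in> cores t" "S = beads xs 0"
      by blast
    then show "S \<in> {S. maya S \<and> energy 0 1 S = 0 \<and> (\<forall>x\<in>S. x - int t \<in> S)}"
      using cores_iff_beads maya_beads charge_beads by simp
  qed
qed auto

lemma bij_betw_charge_vectors:
  assumes "t > 0"
  shows "bij_betw (\<lambda>c. interleave t (\<lambda>r. {..<c r})) (charge_vectors t)
    {S. maya S \<and> energy 0 1 S = 0 \<and> (\<forall>x\<in>S. x - int t \<in> S)}"
    (is "bij_betw ?f ?A ?B")
  unfolding bij_betw_def
proof
  show "inj_on ?f ?A"
  proof (rule inj_onI)
    fix c d assume cd: "c \<in> ?A" "d \<in> ?A" and eq: "?f c = ?f d"
    have "c r = d r" if "r < t" for r
      using arg_cong[OF eq, of "\<lambda>S. runner t S r"] that by (simp add: runner_interleave)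
    then show "c = d"
      using cd by (intro PiE_ext[of _ "{..<t}" "\<lambda>_. UNIV"]) (auto simp: charge_vectors_def)
  qed
  note em = energy_interleave_beads[OF assms, of "\<lambda>_. []"]
  show "?f ` ?A = ?B"
  proof (intro equalityI subsetI)
    fix S assume "S \<in> ?f ` ?A"
    then obtain c where c: "c \<in> ?A" "S = ?f c"
      by auto
    have "x - int t \<in> S" if "x \<in> S" for x
    proof -
      have "(x - int t) mod int t = x mod int t" "(x - int t) div int t = x div int t - 1"
        using assms div_mult_self1[of "int t" x "- 1"] by simp_all
      then show ?thesis
        using that by (simp add: c interleave_def)
    qed
    then show "S \<in> ?B"
      using em(1,2)[of c] c by (auto simp: part_lists_def charge_vectors_def)
  next
    fix S assume S: "S \<in> ?B"
    define c where "c = restrict (\<lambda>r. energy 0 1 (runner t S r)) {..<t}"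
    have run: "runner t S r = {..<c r}" if "r < t" for r
    proof -
      have "x - 1 \<in> runner t S r" if "x \<in> runner t S r" for x
        using S that by (auto simp: runner_def algebra_simps)
      then show ?thesis
        using maya_down_closed[OF maya_runner[of S r t]] S that by (auto simp: c_def)
    qed
    have "S = interleave t (runner t S)"
      using assms by (simp add: interleave_runner)
    also have "\<dots> = ?f c"
      using run by (rule interleave_cong[OF assms])
    finally have Sc: "S = ?f c" .
    then have "c \<in> ?A"
      using em(2)[of c] S by (auto simp: charge_vectors_def c_def part_lists_def)
    then show "S \<in> ?f ` ?A"
      using Sc by blast
  qed
qed

text \<open>That \<open>charge_weight\<close> is nonnegative with finite fibres on vectors of sum 0
  is not read off its formula, but inherited from the size of partitions through the
  bijections.\<close>

lemma charge_vectors_gf: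
  assumes "t > 0"
  shows "graded (charge_vectors t) (charge_weight t)"
    and "gf (charge_vectors t) (\<lambda>_. 1) (charge_weight t) = gf (cores t) (\<lambda>_. 1) (\<lambda>\<pi>. int (\<Sum>\<^sub># \<pi>))"
proof -
  let ?K = "{xs \<in> part_lists. mset xs \<in> cores t}"
  let ?B = "{S. maya S \<and> energy 0 1 S = 0 \<and> (\<forall>x\<in>S. x - int t \<in> S)}"
  have wK: "energy 1 0 (beads xs 0) = int (sum_list xs)" if "xs \<in> ?K" for xs
    using that by (simp add: energy_beads_0)
  have wc: "energy 1 0 (interleave t (\<lambda>r. {..<c r})) = charge_weight t c" for c
    using energy_interleave_beads(3)[OF assms, of "\<lambda>_. []" c] by (simp add: part_lists_def)
  have "graded ?K (\<lambda>xs. int (sum_list xs))"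
    by (rule graded_subset[OF graded_part_lists]) auto
  then have grB: "graded ?B (energy 1 0)"
    using wK by (intro graded_bij[OF bij_betw_cores])
  show "graded (charge_vectors t) (charge_weight t)"
    using bij_betw_imp_surj_on[OF bij_betw_charge_vectors[OF assms]] wc
    by (intro graded_inj[OF bij_betw_imp_inj_on[OF bij_betw_charge_vectors[OF assms]] _ _ grB]) simp_all
  have "gf (charge_vectors t) (\<lambda>_. 1) (charge_weight t) = gf ?B (\<lambda>_. 1) (energy 1 0)"
    using wc by (intro gf_reindex[OF bij_betw_charge_vectors[OF assms]]) auto
  also have "\<dots> = gf ?K (\<lambda>_. 1) (\<lambda>xs. int (sum_list xs))"
    using wK by (intro gf_reindex[OF bij_betw_cores, symmetric]) auto
  also have "\<dots> = gf (cores t) (\<lambda>_. 1) (\<lambda>\<pi>. int (\<Sum>\<^sub># \<pi>))"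
  proof (rule gf_reindex)
    show "bij_betw mset ?K (cores t)"
    proof (rule bij_betw_subset[OF bij_betw_mset])
      show "mset ` ?K = cores t"
      proof (intro equalityI subsetI)
        fix \<pi> assume \<pi>: "\<pi> \<in> cores t"
        then have "\<pi> \<in> mset ` part_lists"
          unfolding bij_betw_imp_surj_on[OF bij_betw_mset] by (simp add: cores_def)
        then show "\<pi> \<in> mset ` ?K"
          using \<pi> by blast
      qed auto
    qed auto
  qed (auto simp: sum_mset_sum_list)
  finally show "gf (charge_vectors t) (\<lambda>_. 1) (charge_weight t) = gf (cores t) (\<lambda>_. 1) (\<lambda>\<pi>. int (\<Sum>\<^sub># \<pi>))" .
qed

text \<open>Counting all partitions by core and quotient gives \<open>part_gf {1..}\<close> as the
  core series times a \<open>t\<close>-th power in X^t, because a quotient part counts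
  \<open>t\<close> times. \<open>euler_part_gf\<close> then clears both partition series.\<close>

theorem gf_cores:
  assumes "t > 0"
  shows "gf (cores t) (\<lambda>_. 1) (\<lambda>\<pi>. int (\<Sum>\<^sub># \<pi>)) * euler {1..} = (euler {1..} oo fps_X ^ t) ^ t"
proof -
  let ?T = "gf (cores t) (\<lambda>_. 1) (\<lambda>\<pi>. int (\<Sum>\<^sub># \<pi>))"
  let ?p = "part_gf {1..} oo fps_X ^ t" and ?e = "euler {1..} oo fps_X ^ t"
  let ?Y = "PiE {..<t} (\<lambda>_. part_lists)" and ?w = "\<lambda>L. \<Sum>r<t. int t * int (sum_list (L r))"
  let ?B = "{S. maya S \<and> energy 0 1 S = 0}"
  have Y: "graded ?Y ?w" "gf ?Y (\<lambda>_. 1) ?w = ?p ^ t"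
    using gf_PiE[of "{..<t}" part_lists "\<lambda>xs. int t * int (sum_list xs)"] assms
      gf_scale[OF graded_part_lists assms, of "\<lambda>_. 1"] graded_scale[OF graded_part_lists assms]
    by (simp_all add: gf_part_lists)
  have "part_gf {1..} = gf part_lists (\<lambda>_. 1) (\<lambda>xs. int (sum_list xs))"
    by (simp add: gf_part_lists)
  also have "\<dots> = gf ?B (\<lambda>_. 1) (energy 1 0)"
    using energy_beads_0 by (intro gf_reindex[OF bij_betw_beads_0]) auto
  also have "\<dots> = gf (charge_vectors t \<times> ?Y) (\<lambda>_. 1 * 1) (\<lambda>p. charge_weight t (fst p) + ?w (snd p))"
  proof (rule gf_reindex[OF bij_betw_quotient[OF assms], symmetric])
    fix p assume "p \<in> charge_vectors t \<times> ?Y"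
    then have "snd p r \<in> part_lists" if "r < t" for r
      using that PiE_mem[of "snd p" "{..<t}" "\<lambda>_. part_lists" r] by (simp add: mem_Times_iff)
    then show "energy 1 0 (interleave t (\<lambda>r. beads (snd p r) (fst p r))) = charge_weight t (fst p) + ?w (snd p)"
      by (rule energy_interleave_beads(3)[OF assms])
  qed simp
  also have "\<dots> = gf (charge_vectors t) (\<lambda>_. 1) (charge_weight t) * gf ?Y (\<lambda>_. 1) ?w"
    by (rule gf_times[OF charge_vectors_gf(1)[OF assms] Y(1), symmetric])
  also have "\<dots> = ?T * ?p ^ t"
    by (simp only: Y charge_vectors_gf(2)[OF assms])
  finally have P: "part_gf {1..} = ?T * ?p ^ t" .
  have e: "euler {1..} * part_gf {1..} = 1"
    by (rule euler_part_gf) simp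
  then have "?e * ?p = 1"
    using assms fps_compose_mult_distrib[of "fps_X ^ t" "euler {1..}" "part_gf {1..}"] by simp
  then have ep: "?e ^ t * ?p ^ t = 1"
    by (simp flip: power_mult_distrib)
  have "?T * euler {1..} = ?T * euler {1..} * (?e ^ t * ?p ^ t)"
    by (simp only: ep mult_1_right)
  also have "\<dots> = (euler {1..} * (?T * ?p ^ t)) * ?e ^ t"
    by (simp only: mult_ac)
  also have "\<dots> = ?e ^ t"
    by (simp only: P[symmetric] e mult_1_left)
  finally show ?thesis .
qed

section \<open>Ramanujan's identity of degree 11\<close>

text \<open>In the coordinates \<open>x = 10 a - 4 b + 3\<close>, \<open>y = 2 b + 1\<close> this is \<open>(x\<^sup>2 + 11 y\<^sup>2 - 20) / 40\<close>;
  the pairs \<open>(x, y)\<close> run through the odd ones with \<open>x + 2 y\<close> divisible by 5.\<close>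

definition form_weight :: "int \<times> int \<Rightarrow> int" where
  "form_weight p = (5 * fst p * fst p + 3 * snd p * snd p - 4 * fst p * snd p + 3 * fst p + snd p) div 2"

definition form_sign :: "int \<times> int \<Rightarrow> int" where
  "form_sign p = sign (fst p + snd p)"

lemma two_form_weight: "2 * form_weight (a, b) = 5 * a * a + 3 * b * b - 4 * a * b + 3 * a + b"
proof -
  have "even (5 * a * a + 3 * b * b - 4 * a * b + 3 * a + b)"
    by auto
  then show ?thesis
    by (simp add: form_weight_def)
qed

lemma form_weight_eqI:
  "5 * a * a + 3 * b * b - 4 * a * b + 3 * a + b = 2 * w \<Longrightarrow> form_weight (a, b) = w"
  using two_form_weight[of a b] by simp

text \<open>Completing the square gives x^2 + 11 y^2 = 40 w + 20 for a point of weight w. Integers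
  satisfy |x| <= x^2, so both coordinates are at most 40 w + 20 in absolute value.\<close>

lemma graded_form: "graded UNIV form_weight"
proof -
  have sq: "(10 * a - 4 * b + 3) * (10 * a - 4 * b + 3) + 11 * ((2 * b + 1) * (2 * b + 1)) = 40 * form_weight (a, b) + 20" for a b
    using two_form_weight[of a b] by (simp add: algebra_simps)
  have abs_le: "\<bar>x\<bar> \<le> x * x" for x :: int
    using mult_left_mono[of 1 "\<bar>x\<bar>" "\<bar>x\<bar>"] by (cases "x = 0") (auto simp flip: abs_mult)
  have bound: "\<bar>10 * a - 4 * b + 3\<bar> \<le> 40 * form_weight (a, b) + 20 \<and> \<bar>2 * b + 1\<bar> \<le> 40 * form_weight (a, b) + 20" for a b
    using sq[of a b] abs_le[of "10 * a - 4 * b + 3"] abs_le[of "2 * b + 1"] by linarith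
  show ?thesis
  proof (rule gradedI)
    show "0 \<le> form_weight p" for p
      using bound[of "fst p" "snd p"] unfolding prod.collapse by linarith
    show "finite {p. p \<in> UNIV \<and> form_weight p = int n}" for n
    proof (rule finite_subset)
      let ?M = "40 * int n + 20"
      show "{p. p \<in> UNIV \<and> form_weight p = int n} \<subseteq> {- ?M..?M} \<times> {- ?M..?M}"
      proof
        fix p assume "p \<in> {p. p \<in> UNIV \<and> form_weight p = int n}"
        then have "\<bar>10 * fst p - 4 * snd p + 3\<bar> \<le> ?M" "\<bar>2 * snd p + 1\<bar> \<le> ?M"
          using bound[of "fst p" "snd p"] by simp_all
        then have "- ?M \<le> fst p" "fst p \<le> ?M" "- ?M \<le> snd p" "snd p \<le> ?M"
          by linarith+
        then show "p \<in> {- ?M..?M} \<times> {- ?M..?M}"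
          by (simp add: mem_Times_iff)
      qed
    qed simp
  qed
qed

lemma gf_form_Un: "S \<inter> T = {} \<Longrightarrow> gf (S \<union> T) form_sign form_weight = gf S form_sign form_weight + gf T form_sign form_weight"
  by (intro gf_Un graded_subset[OF graded_form]) auto

text \<open>The point reflection (x, y) -> (-x, -y) preserves weight and sign. It pairs the residue
  classes and thereby causes the factor 2 in both evaluations.\<close>

lemma gf_form_reflect:
  assumes "\<And>a b. P a b \<longleftrightarrow> Q (- a - 1) (- b - 1)"
  shows "gf {p. P (fst p) (snd p)} form_sign form_weight = gf {p. Q (fst p) (snd p)} form_sign form_weight"
proof (rule gf_reindex)
  let ?f = "\<lambda>p :: int \<times> int. (- fst p - 1, - snd p - 1)"
  have "Q a b \<longleftrightarrow> P (- a - 1) (- b - 1)" for a b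
    using assms[of "- a - 1" "- b - 1"] by simp
  then show "bij_betw ?f {p. P (fst p) (snd p)} {p. Q (fst p) (snd p)}"
    using assms by (intro bij_betwI[of _ _ _ ?f]) auto
  show "form_sign (?f p) = form_sign p" for p
    by (auto simp: form_sign_def sign_def)
  show "form_weight (?f p) = form_weight p" for p
    using two_form_weight[of "fst p" "snd p"] by (intro form_weight_eqI) (simp add: algebra_simps)
qed

lemma theta_mult_theta_11:
  assumes "0 < k" "k < m" "0 < k'" "k' < m'"
  shows "theta m k * (theta m' k' oo fps_X ^ 11) = gf UNIV (\<lambda>p. sign (fst p) * sign (snd p))
    (\<lambda>p. (int k * fst p + int m * tri (fst p)) + 11 * (int k' * snd p + int m' * tri (snd p)))"
    and "graded UNIV (\<lambda>p. (int k * fst p + int m * tri (fst p)) + 11 * (int k' * snd p + int m' * tri (snd p)))"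
proof -
  note g = graded_theta[OF assms(1,2)] graded_scale[OF graded_theta[OF assms(3,4)], of 11]
  show "theta m k * (theta m' k' oo fps_X ^ 11) = gf UNIV (\<lambda>p. sign (fst p) * sign (snd p))
    (\<lambda>p. (int k * fst p + int m * tri (fst p)) + 11 * (int k' * snd p + int m' * tri (snd p)))"
    using gf_times[OF g, of sign sign] gf_scale[OF graded_theta[OF assms(3,4)], of 11 sign]
    by (simp add: theta_def)
  show "graded UNIV (\<lambda>p. (int k * fst p + int m * tri (fst p)) + 11 * (int k' * snd p + int m' * tri (snd p)))"
    using graded_times[OF g] by simp
qed

text \<open>The pairs \<open>(a, b)\<close> with \<open>3\<close> dividing \<open>2 a + 1\<close> are cancelled by the reflection \<open>v \<mapsto> - v\<close> in the
  coordinates \<open>v = 2 a + 1\<close>, \<open>u = 2 v - 3 y\<close>, in which the form is \<open>5 (u\<^sup>2 + 11 v\<^sup>2) / 3\<close>.\<close>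

lemma gf_form_mod_3: "gf UNIV form_sign form_weight = 2 * (theta 3 1 * (theta 3 1 oo fps_X ^ 11))"
proof -
  let ?G = "\<lambda>S. gf S form_sign form_weight"
  let ?A = "\<lambda>r. {p :: int \<times> int. fst p mod 3 = r}"
  have U: "UNIV = (?A 0 \<union> ?A 2) \<union> ?A 1"
    by auto
  have th: "theta 3 1 * (theta 3 1 oo fps_X ^ 11) = gf UNIV (\<lambda>p. sign (fst p) * sign (snd p))
      (\<lambda>p. fst p + 3 * tri (fst p) + 11 * (snd p + 3 * tri (snd p)))"
    using theta_mult_theta_11(1)[of 1 3 1 3] by simp
  have "?G UNIV = ?G (?A 0) + ?G (?A 2) + ?G (?A 1)"
    unfolding U by (subst gf_form_Un, force)+ simp
  also have "?G (?A 2) = ?G (?A 0)"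
    by (rule gf_form_reflect) presburger
  also have "?G (?A 1) = 0"
  proof (rule gf_involution)
    \<comment> \<open>For a = 3 e + 1 one has v = 3 (2 e + 1). Keeping u = 2 v - 3 y while v changes
      sign lowers y by 4 v / 3, hence b by 4 e + 2; then a + b changes by an odd number and the sign
      flips.\<close>
    let ?f = "\<lambda>p :: int \<times> int. (- fst p - 1, snd p - 4 * (fst p div 3) - 2)"
    fix p assume "p \<in> ?A 1"
    then have "fst p = 3 * (fst p div 3) + 1"
      unfolding mem_Collect_eq by presburger
    then obtain e b where p: "p = (3 * e + 1, b)"
      by (metis prod.collapse)
    have d: "(3 * e + 1) div 3 = e" "(- 2 - 3 * e) div 3 = - e - 1" "(- 2 - 3 * e) mod 3 = 1"
      by presburger+
    show "?f p \<in> ?A 1" "?f (?f p) = p"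
      by (simp_all add: p d)
    show "form_sign (?f p) = - form_sign p"
      by (simp add: p d form_sign_def sign_def)
    show "form_weight (?f p) = form_weight p"
      unfolding p fst_conv snd_conv d
      by (rule form_weight_eqI, subst two_form_weight) (simp add: algebra_simps)
  qed
  also have "?G (?A 0) = theta 3 1 * (theta 3 1 oo fps_X ^ 11)"
    unfolding th
  proof (rule gf_reindex[symmetric])
    \<comment> \<open>For the pair (c, d) this means u = 6 c - 1 and v = - (6 d - 1). The exponent w
      of the theta product satisfies u^2 + 11 v^2 = 24 w + 12, and 5/3 of this is 40 w + 20.\<close>
    let ?f = "\<lambda>p :: int \<times> int. (- 3 * snd p, - fst p - 2 * snd p)"
    have d: "- (3 * b) div 3 = - b" for b :: int
      by presburger
    show "bij_betw ?f UNIV (?A 0)"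
      by (rule bij_betwI[of _ _ _ "\<lambda>p. (- snd p + 2 * (fst p div 3), - (fst p div 3))"])
        (auto simp: mod_eq_0_iff_dvd d)
    show "form_sign (?f p) = sign (fst p) * sign (snd p)" for p
      by (auto simp: form_sign_def sign_def)
    show "form_weight (?f p) = fst p + 3 * tri (fst p) + 11 * (snd p + 3 * tri (snd p))" for p
      using two_tri[of "fst p"] two_tri[of "snd p"] by (intro form_weight_eqI) (simp add: algebra_simps)
  qed
  finally show ?thesis
    by simp
qed

text \<open>Here the pairs with \<open>5\<close> dividing \<open>y = 2 b + 1\<close> are cancelled by the reflection \<open>y \<mapsto> - y\<close>, which
  fixes \<open>x\<close>.\<close>

lemma gf_form_mod_5:
  "gf UNIV form_sign form_weight = 2 * (theta 5 1 * (theta 5 2 oo fps_X ^ 11) -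
    fps_X ^ 2 * (theta 5 2 * (theta 5 1 oo fps_X ^ 11)))"
proof -
  let ?G = "\<lambda>S. gf S form_sign form_weight"
  let ?B = "\<lambda>r. {p :: int \<times> int. snd p mod 5 = r}"
  have U: "UNIV = (((?B 0 \<union> ?B 4) \<union> ?B 3) \<union> ?B 1) \<union> ?B 2"
    by auto
  have th: "theta 5 1 * (theta 5 2 oo fps_X ^ 11) = gf UNIV (\<lambda>p. sign (fst p) * sign (snd p))
      (\<lambda>p. fst p + 5 * tri (fst p) + 11 * (2 * snd p + 5 * tri (snd p)))"
    using theta_mult_theta_11(1)[of 1 5 2 5] by simp
  have "graded UNIV (\<lambda>p :: int \<times> int. 2 * fst p + 5 * tri (fst p) + 11 * (snd p + 5 * tri (snd p)))"
    using theta_mult_theta_11(2)[of 2 5 1 5] by simp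
  note shift = gf_X_power[OF this, of 2]
  have th': "theta 5 2 * (theta 5 1 oo fps_X ^ 11) = gf UNIV (\<lambda>p. sign (fst p) * sign (snd p))
      (\<lambda>p. 2 * fst p + 5 * tri (fst p) + 11 * (snd p + 5 * tri (snd p)))"
    using theta_mult_theta_11(1)[of 2 5 1 5] by simp
  have "?G UNIV = ?G (?B 0) + ?G (?B 4) + ?G (?B 3) + ?G (?B 1) + ?G (?B 2)"
    unfolding U by (subst gf_form_Un, force)+ simp
  also have "?G (?B 0) = ?G (?B 4)"
    by (rule gf_form_reflect) presburger
  also have "?G (?B 3) = ?G (?B 1)"
    by (rule gf_form_reflect) presburger
  also have "?G (?B 2) = 0"
  proof (rule gf_involution)
    \<comment> \<open>For b = 5 e + 2, keeping x = 10 a - 4 b + 3 while y changes sign lowers a by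
      (4 b + 2) / 5 = 4 e + 2. Again a + b changes by an odd number.\<close>
    let ?f = "\<lambda>p :: int \<times> int. (fst p - 4 * (snd p div 5) - 2, - snd p - 1)"
    fix p assume "p \<in> ?B 2"
    then have "snd p = 5 * (snd p div 5) + 2"
      unfolding mem_Collect_eq by presburger
    then obtain a e where p: "p = (a, 5 * e + 2)"
      by (metis prod.collapse)
    have d: "(5 * e + 2) div 5 = e" "(- 3 - 5 * e) div 5 = - e - 1" "(- 3 - 5 * e) mod 5 = 2"
      by presburger+
    show "?f p \<in> ?B 2" "?f (?f p) = p"
      by (simp_all add: p d)
    show "form_sign (?f p) = - form_sign p"
      by (simp add: p d form_sign_def sign_def)
    show "form_weight (?f p) = form_weight p"
      unfolding p fst_conv snd_conv d
      by (rule form_weight_eqI, subst two_form_weight) (simp add: algebra_simps)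
  qed
  also have "?G (?B 4) = theta 5 1 * (theta 5 2 oo fps_X ^ 11)"
    unfolding th
  proof (rule gf_reindex[symmetric])
    \<comment> \<open>For the pair (c, d) this is the point x = 10 c - 3, y = 10 d - 1. The constant
      terms of the squares give 9 + 11 = 20, so no power of X appears.\<close>
    let ?f = "\<lambda>p :: int \<times> int. (fst p + 2 * snd p - 1, 5 * snd p - 1)"
    have d: "(5 * n - 1) mod 5 = 4" for n :: int
      by presburger
    have d': "5 * ((b + 1) div 5) = b + 1" if "b mod 5 = 4" for b :: int
      using that by presburger
    show "bij_betw ?f UNIV (?B 4)"
      by (rule bij_betwI[of _ _ _ "\<lambda>p. (fst p + 1 - 2 * ((snd p + 1) div 5), (snd p + 1) div 5)"])
        (auto simp: d d')
    show "form_sign (?f p) = sign (fst p) * sign (snd p)" for p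
      by (auto simp: form_sign_def sign_def)
    show "form_weight (?f p) = fst p + 5 * tri (fst p) + 11 * (2 * snd p + 5 * tri (snd p))" for p
      using two_tri[of "fst p"] two_tri[of "snd p"] by (intro form_weight_eqI) (simp add: algebra_simps)
  qed
  also have "?G (?B 1) = - (fps_X ^ 2 * (theta 5 2 * (theta 5 1 oo fps_X ^ 11)))"
    unfolding th' shift gf_uminus[symmetric]
  proof (rule gf_reindex[symmetric])
    \<comment> \<open>Here x = 10 c - 1 and y = 3 - 10 d. The constant terms give 1 + 99 = 20 + 2 *
      40, which is the factor X^2, and a + b has the parity of c + d + 1, which is the minus
      sign.\<close>
    let ?f = "\<lambda>p :: int \<times> int. (fst p - 2 * snd p, 1 - 5 * snd p)"
    have d: "(1 - 5 * n) mod 5 = 1" for n :: int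
      by presburger
    have d': "5 * ((1 - b) div 5) = 1 - b" if "b mod 5 = 1" for b :: int
      using that by presburger
    show "bij_betw ?f UNIV (?B 1)"
      by (rule bij_betwI[of _ _ _ "\<lambda>p. (fst p + 2 * ((1 - snd p) div 5), (1 - snd p) div 5)"])
        (auto simp: d d')
    show "form_sign (?f p) = - (sign (fst p) * sign (snd p))" for p
      by (auto simp: form_sign_def sign_def)
    show "form_weight (?f p) = int 2 + (2 * fst p + 5 * tri (fst p) + 11 * (snd p + 5 * tri (snd p)))" for p
      using two_tri[of "fst p"] two_tri[of "snd p"] by (intro form_weight_eqI) (simp add: algebra_simps)
  qed
  finally show ?thesis
    by simp
qed

theorem theta_identity_11:
  "theta 5 1 * (theta 5 2 oo fps_X ^ 11) - fps_X ^ 2 * (theta 5 2 * (theta 5 1 oo fps_X ^ 11)) =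
    theta 3 1 * (theta 3 1 oo fps_X ^ 11)"
proof -
  have "2 * (theta 5 1 * (theta 5 2 oo fps_X ^ 11) - fps_X ^ 2 * (theta 5 2 * (theta 5 1 oo fps_X ^ 11))) =
      2 * (theta 3 1 * (theta 3 1 oo fps_X ^ 11))"
    by (rule trans[OF gf_form_mod_5[symmetric] gf_form_mod_3])
  then show ?thesis
    unfolding mult_cancel_left by simp
qed

section \<open>Capsids\<close>

text \<open>The functional equation of the q-binomial series, truncated at \<open>N\<close>.\<close>

lemma q_binomial_step:
  fixes z a Q :: "'a::comm_ring_1" and c :: "nat \<Rightarrow> 'a"
  assumes "\<And>s. c (Suc s) * (1 - Q ^ Suc s) = c s * (1 - a * Q ^ s)"
  shows "(1 - z) * (\<Sum>s\<le>N. z ^ s * c s) =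
    (1 - a * z) * (\<Sum>s\<le>N. (z * Q) ^ s * c s) + z ^ Suc N * ((a * Q ^ N - 1) * c N)"
proof (induction N)
  case 0
  show ?case
    by (simp add: algebra_simps)
next
  case (Suc N)
  have "(1 - z) * (\<Sum>s\<le>Suc N. z ^ s * c s) =
      (1 - a * z) * (\<Sum>s\<le>N. (z * Q) ^ s * c s) - z ^ Suc N * (c N * (1 - a * Q ^ N)) + (1 - z) * (z ^ Suc N * c (Suc N))"
    using Suc by (simp add: algebra_simps)
  also have "\<dots> = (1 - a * z) * (\<Sum>s\<le>Suc N. (z * Q) ^ s * c s) + z ^ Suc (Suc N) * ((a * Q ^ Suc N - 1) * c (Suc N))"
    unfolding assms[symmetric] by (simp add: algebra_simps power_mult_distrib)
  finally show ?case .
qed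

lemma part_gf_insert:
  assumes "j \<notin> J" "0 \<notin> insert j J"
  shows "part_gf (insert j J) * (1 - fps_X ^ j) = part_gf J"
proof -
  have "part_gf (insert j J) * (1 - fps_X ^ j) = part_gf (insert j J) * (1 - fps_X ^ j) * (euler J * part_gf J)"
    using assms by (simp add: euler_part_gf)
  also have "\<dots> = (euler (insert j J) * part_gf (insert j J)) * part_gf J"
    using euler_Un[of "{j}" J] assms by (simp add: euler_singleton mult_ac)
  also have "\<dots> = part_gf J"
    using euler_part_gf[OF assms(2)] by simp
  finally show ?thesis .
qed

lemma count_le_sum_mset: "0 < x \<Longrightarrow> count \<pi> x \<le> \<Sum>\<^sub># \<pi>" for x :: nat
  by (induction \<pi>) auto

lemma graded_capsids: "graded (capsids m k) (\<lambda>\<pi>. int (\<Sum>\<^sub># \<pi>))"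
  by (rule graded_subset[OF graded_partitions[of "{1..}"]]) (auto simp: capsids_def is_partition_iff)

text \<open>Once the multiplicity \<open>s\<close> of \<open>m - k\<close> is fixed, the multiples
  of \<open>m\<close> and the parts congruent to \<open>k\<close> are two independent multisets. For
  \<open>s = 0\<close> the set \<open>?D\<close> is empty and \<open>?U\<close> the entire residue
  class, so both clauses of the definition lead to one formula.\<close>

lemma gf_capsids_count:
  assumes "0 < k" "k < m" "2 * k \<noteq> m"
  shows "gf {\<pi> \<in> capsids m k. count \<pi> (m - k) = s} (\<lambda>_. 1) (\<lambda>\<pi>. int (\<Sum>\<^sub># \<pi>)) =
    fps_X ^ (s * (m - k)) *
      (part_gf (residue_class m 0 \<inter> {..m * s}) * part_gf (residue_class m k \<inter> {m * s<..}))"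
proof -
  let ?D = "residue_class m 0 \<inter> {..m * s}" and ?U = "residue_class m k \<inter> {m * s<..}"
  let ?A = "{\<alpha>. set_mset \<alpha> \<subseteq> ?D}" and ?B = "{\<beta>. set_mset \<beta> \<subseteq> ?U}"
  let ?r = "replicate_mset s (m - k)"
  let ?C = "{\<pi> \<in> capsids m k. count \<pi> (m - k) = s}"
  have mk: "(m - k) mod m = m - k" "m - k \<noteq> k" "0 < m - k" "m - k < m"
    using assms by auto
  have D: "p mod m = 0 \<and> 0 < p \<and> p \<le> m * s \<and> p \<noteq> m - k \<and> m \<le> p" if "p \<in> ?D" for p
    using that mk by (auto simp: residue_class_def dvd_imp_le)
  have U: "p mod m = k \<and> 0 < p \<and> m * s < p \<and> p \<noteq> m - k" if "p \<in> ?U" for p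
    using that mk by (auto simp: residue_class_def)
  have bij: "bij_betw (\<lambda>p. ?r + (fst p + snd p)) (?A \<times> ?B) ?C"
  proof (rule bij_betwI[of _ _ _ "\<lambda>\<pi>. (filter_mset (\<lambda>p. p mod m = 0) \<pi>, filter_mset (\<lambda>p. p mod m = k) \<pi>)"])
    show "(\<lambda>p. ?r + (fst p + snd p)) \<in> ?A \<times> ?B \<rightarrow> ?C"
    proof
      fix q assume "q \<in> ?A \<times> ?B"
      then obtain \<alpha> \<beta> where q: "q = (\<alpha>, \<beta>)" "\<And>p. p \<in># \<alpha> \<Longrightarrow> p \<in> ?D" "\<And>p. p \<in># \<beta> \<Longrightarrow> p \<in> ?U"
        by (cases q) auto
      have "m - k \<notin># \<alpha>" "m - k \<notin># \<beta>"
        using q D U by blast+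
      then have cnt: "count (?r + (\<alpha> + \<beta>)) (m - k) = s"
        by (simp add: not_in_iff)
      have P: "(p = m - k \<and> 0 < s) \<or> (p mod m = 0 \<and> 0 < p \<and> p \<le> m * s \<and> m \<le> p \<and> 0 < s) \<or>
          (p mod m = k \<and> 0 < p \<and> m * s < p)" if "p \<in># ?r + (\<alpha> + \<beta>)" for p
      proof -
        consider "p \<in># ?r" | "p \<in># \<alpha>" | "p \<in># \<beta>"
          using \<open>p \<in># ?r + (\<alpha> + \<beta>)\<close> unfolding union_iff by blast
        then show ?thesis
        proof cases
          case 1
          then show ?thesis
            by (auto simp: in_replicate_mset split: if_splits)
        next
          case 2
          then show ?thesis
            using D[OF q(2)[OF 2]] by (cases s) auto
        next
          case 3
          then show ?thesis
            using U[OF q(3)[OF 3]] by auto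
        qed
      qed
      have "?r + (\<alpha> + \<beta>) \<in> capsids m k"
        unfolding capsids_def mem_Collect_eq is_partition_def cnt cong_def
      proof (intro conjI impI ballI)
        show "0 \<notin># ?r + (\<alpha> + \<beta>)"
        proof
          assume "0 \<in># ?r + (\<alpha> + \<beta>)"
          from P[OF this] show False
            using mk(3) by linarith
        qed
        fix p assume p: "p \<in># ?r + (\<alpha> + \<beta>)"
        show "p = m - k \<or> p mod m = 0 mod m \<or> p mod m = k mod m"
          using P[OF p] assms by auto
        show "p mod m = k mod m" if "s = 0"
          using P[OF p] that assms by auto
        \<comment> \<open>Minimality of \<open>m - k\<close> is automatic: the other parts are at
          least \<open>m\<close>.\<close>
        show "m - k \<le> p" if "0 < s"
        proof -
          have "m \<le> m * s"
            using that by simp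
          then have "m - k \<le> p" if "m * s < p"
            using that by linarith
          then show ?thesis
            using P[OF p] by (elim disjE conjE) simp_all
        qed
        show "p \<le> m * s" if "p mod m = 0 mod m"
          using P[OF p] that mk(1,3) assms(1) by (elim disjE conjE) simp_all
        show "p > m * s" if "p mod m = k mod m \<and> \<not> (2 * k = m \<and> p = m - k)"
          using P[OF p] that mk(1,2) assms(1,2) by (elim disjE conjE) simp_all
      qed
      then show "?r + (fst q + snd q) \<in> ?C"
        using cnt q by simp
    qed
    show "(\<lambda>\<pi>. (filter_mset (\<lambda>p. p mod m = 0) \<pi>, filter_mset (\<lambda>p. p mod m = k) \<pi>)) \<in> ?C \<rightarrow> ?A \<times> ?B"
    proof
      fix \<pi> assume \<pi>: "\<pi> \<in> ?C"
      then have s: "count \<pi> (m - k) = s" and cap: "\<pi> \<in> capsids m k"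
        by auto
      have pos: "0 < p" if "p \<in># \<pi>" for p
        using cap that by (cases p) (auto simp: capsids_def is_partition_def)
      have s0: "p mod m = k" if "s = 0" "p \<in># \<pi>" for p
        using cap s that assms(2) by (simp add: capsids_def cong_def)
      have D': "p \<le> m * s" if "0 < s" "p \<in># \<pi>" "p mod m = 0" for p
        using cap s that by (simp add: capsids_def cong_def del: count_greater_zero_iff)
      have U': "m * s < p" if "0 < s" "p \<in># \<pi>" "p mod m = k" for p
        using cap s that assms(2,3) by (simp add: capsids_def cong_def del: count_greater_zero_iff)
      have "p \<in> ?D" if "p \<in># \<pi>" "p mod m = 0" for p
        using pos[of p] s0[of p] D'[of p] that assms(1) by (cases "s = 0") (simp_all add: residue_class_def)
      moreover have "p \<in> ?U" if "p \<in># \<pi>" "p mod m = k" for p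
        using pos[of p] U'[of p] that by (cases "s = 0") (simp_all add: residue_class_def)
      ultimately show "(filter_mset (\<lambda>p. p mod m = 0) \<pi>, filter_mset (\<lambda>p. p mod m = k) \<pi>) \<in> ?A \<times> ?B"
        by auto
    qed
    show "(filter_mset (\<lambda>p. p mod m = 0) (?r + (fst q + snd q)), filter_mset (\<lambda>p. p mod m = k) (?r + (fst q + snd q))) = q"
      if "q \<in> ?A \<times> ?B" for q
    proof -
      obtain \<alpha> \<beta> where q: "q = (\<alpha>, \<beta>)" "\<And>p. p \<in># \<alpha> \<Longrightarrow> p \<in> ?D" "\<And>p. p \<in># \<beta> \<Longrightarrow> p \<in> ?U"
        using \<open>q \<in> ?A \<times> ?B\<close> by (cases q) auto
      have "filter_mset (\<lambda>p. p mod m = 0) \<alpha> = \<alpha>" "filter_mset (\<lambda>p. p mod m = k) \<beta> = \<beta>"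
        using q D U by (simp_all add: filter_mset_eq_conv)
      moreover have "filter_mset (\<lambda>p. p mod m = k) \<alpha> = {#}" "filter_mset (\<lambda>p. p mod m = 0) \<beta> = {#}"
        unfolding filter_mset_eq_mempty_iff using D[OF q(2)] U[OF q(3)] assms(1) by fastforce+
      moreover have "filter_mset (\<lambda>p. p mod m = k) ?r = {#}" "filter_mset (\<lambda>p. p mod m = 0) ?r = {#}"
        using mk by (auto simp: in_replicate_mset)
      ultimately show ?thesis
        by (simp add: q)
    qed
    show "?r + (fst (filter_mset (\<lambda>p. p mod m = 0) \<pi>, filter_mset (\<lambda>p. p mod m = k) \<pi>) +
        snd (filter_mset (\<lambda>p. p mod m = 0) \<pi>, filter_mset (\<lambda>p. p mod m = k) \<pi>)) = \<pi>" if "\<pi> \<in> ?C" for \<pi>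
    proof (rule multiset_eqI)
      fix p
      have "p = m - k \<or> p mod m = 0 \<or> p mod m = k" if "p \<in># \<pi>"
        using \<open>\<pi> \<in> ?C\<close> that assms by (auto simp: capsids_def cong_def)
      moreover have "count \<pi> (m - k) = s"
        using that by simp
      ultimately show "count (?r + (fst (filter_mset (\<lambda>p. p mod m = 0) \<pi>, filter_mset (\<lambda>p. p mod m = k) \<pi>) +
        snd (filter_mset (\<lambda>p. p mod m = 0) \<pi>, filter_mset (\<lambda>p. p mod m = k) \<pi>))) p = count \<pi> p"
        using mk assms by (cases "p \<in># \<pi>") (auto simp: not_in_iff)
    qed
  qed
  have gr: "graded ?A (\<lambda>\<pi>. int (\<Sum>\<^sub># \<pi>))" "graded ?B (\<lambda>\<pi>. int (\<Sum>\<^sub># \<pi>))"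
    by (rule graded_partitions, simp add: residue_class_def)+
  have "gf ?C (\<lambda>_. 1) (\<lambda>\<pi>. int (\<Sum>\<^sub># \<pi>)) =
      gf (?A \<times> ?B) (\<lambda>_. 1 * 1) (\<lambda>p. int (s * (m - k)) + (int (\<Sum>\<^sub># (fst p)) + int (\<Sum>\<^sub># (snd p))))"
    by (rule gf_reindex[OF bij, symmetric]) auto
  also have "\<dots> = fps_X ^ (s * (m - k)) * (part_gf ?D * part_gf ?U)"
    unfolding part_gf_def gf_times[OF gr] gf_X_power[OF graded_times[OF gr]] ..
  finally show ?thesis .
qed

text \<open>After multiplication by the product over the class of \<open>k\<close>, the sum over
  multiplicities is the q-binomial series with Q = q^m, a = q^k, z = q^(m - k). Since a z = q^m, its
  value is the product over the class of 0 divided by that over the class of m - k. The proof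
  iterates the functional equation z -> z Q modulo X^N.\<close>

theorem gf_capsids:
  assumes "0 < k" "k < m" "2 * k \<noteq> m"
  shows "gf (capsids m k) (\<lambda>_. 1) (\<lambda>\<pi>. int (\<Sum>\<^sub># \<pi>)) *
    (euler (residue_class m k) * euler (residue_class m (m - k))) = euler (residue_class m 0)"
proof (rule fps_eq_uptoI)
  fix N
  let ?R = "residue_class m"
  let ?C = "gf (capsids m k) (\<lambda>_. 1) (\<lambda>\<pi>. int (\<Sum>\<^sub># \<pi>))"
  let ?D = "\<lambda>s. ?R 0 \<inter> {..m * s}" and ?U = "\<lambda>s. ?R k \<inter> {m * s<..}" and ?A = "\<lambda>s. ?R k \<inter> {..m * s}"
  \<comment> \<open>The q-binomial coefficient (q^k; q^m)_s / (q^m; q^m)_s: below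
    \<open>m * s\<close> there are exactly \<open>s\<close> factors in each of the two
    products.\<close>
  define c where "c = (\<lambda>s. part_gf (?D s) * euler (?A s))"
  define z :: "nat \<Rightarrow> int fps" where "z = (\<lambda>j. fps_X ^ (m - k + m * j))"
  define T where "T = (\<lambda>j. \<Sum>s\<le>N. z j ^ s * c s)"
  have z0: "z 0 = fps_X ^ (m - k)" and zS: "z (Suc j) = z j * fps_X ^ m"
    and az: "fps_X ^ k * z j = fps_X ^ (m * Suc j)" for j
    using assms by (auto simp: z_def simp flip: power_add)
  have c0: "c 0 = 1"
  proof -
    have "?D 0 = {}" "?A 0 = {}"
      by (auto simp: residue_class_def)
    then show ?thesis
      using euler_part_gf[of "{}"] by (simp add: c_def mult.commute)
  qed
  have c_Suc: "c (Suc s) * (1 - (fps_X ^ m) ^ Suc s) = c s * (1 - fps_X ^ k * (fps_X ^ m) ^ s)" for s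
  proof -
    have D: "?D (Suc s) = insert (m * Suc s) (?D s)"
    proof (intro equalityI subsetI)
      fix p assume p: "p \<in> ?D (Suc s)"
      then have e: "p = m * (p div m)"
        by (auto simp: residue_class_def)
      then have "m * (p div m) \<le> m * Suc s"
        using p by auto
      then have "p div m = Suc s \<or> p div m \<le> s"
        using assms(2) by (auto simp: le_Suc_eq simp del: mult_Suc_right)
      moreover have "p \<le> m * s" if "p div m \<le> s"
        using e that mult_le_mono2[of "p div m" s m] by simp
      ultimately show "p \<in> insert (m * Suc s) (?D s)"
        using e p by auto
    qed (use assms in \<open>auto simp: residue_class_def\<close>)
    have A: "?A (Suc s) = insert (k + m * s) (?A s)"
    proof (intro equalityI subsetI)
      fix p assume p: "p \<in> ?A (Suc s)"
      then have e: "p = k + m * (p div m)"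
        by (auto simp: residue_class_def)
      then have "m * (p div m) < m * Suc s"
        using p assms(1) by (auto simp: residue_class_def)
      then have "p div m \<le> s"
        by (simp del: mult_Suc_right)
      moreover have "p \<le> m * s" if "p div m < s"
      proof -
        have "m * (p div m) + m \<le> m * s"
          using that by (metis Suc_leI mult_Suc_right mult_le_mono2 add.commute)
        then show ?thesis
          using e assms(2) by linarith
      qed
      ultimately show "p \<in> insert (k + m * s) (?A s)"
        using e p by (cases "p div m = s") auto
    qed (use assms in \<open>auto simp: residue_class_def\<close>)
    have "euler (?A (Suc s)) = (1 - fps_X ^ (k + m * s)) * euler (?A s)"
      using euler_Un[of "{k + m * s}" "?A s"] assms(1) unfolding A by (simp add: euler_singleton)
    moreover have "part_gf (?D (Suc s)) * (1 - fps_X ^ (m * Suc s)) = part_gf (?D s)"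
      unfolding D by (rule part_gf_insert) (use assms in \<open>auto simp: residue_class_def\<close>)
    ultimately show ?thesis
      by (simp add: c_def power_add mult_ac flip: power_mult)
  qed
  \<comment> \<open>The error of the truncated functional equation is a multiple of
    \<open>z j ^ Suc N\<close>, of order above \<open>N\<close> because
    \<open>m - k \<ge> 1\<close>.\<close>
  have step: "fps_eq_upto N ((1 - z j) * T j) ((1 - fps_X ^ (m * Suc j)) * T (Suc j))" for j
  proof -
    have "(1 - z j) * T j = (1 - fps_X ^ (m * Suc j)) * T (Suc j) +
        z j ^ Suc N * ((fps_X ^ k * (fps_X ^ m) ^ N - 1) * c N)"
      unfolding T_def q_binomial_step[of c, OF c_Suc] zS az ..
    moreover have "N \<le> (m - k + m * j) * Suc N"
    proof -
      have "1 * N \<le> (m - k + m * j) * Suc N"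
        using assms by (intro mult_mono) auto
      then show ?thesis
        by simp
    qed
    then have "fps_eq_upto N (z j ^ Suc N * ((fps_X ^ k * (fps_X ^ m) ^ N - 1) * c N)) 0"
      unfolding z_def power_mult[symmetric] by (rule fps_eq_upto_X_power)
    ultimately show ?thesis
      by (simp add: fps_eq_upto_def)
  qed
  have tele: "fps_eq_upto N ((\<Prod>j<J. 1 - z j) * T 0) ((\<Prod>j<J. 1 - fps_X ^ (m * Suc j)) * T J)" for J
  proof (induction J)
    case (Suc J)
    have "fps_eq_upto N ((1 - z J) * ((\<Prod>j<J. 1 - z j) * T 0)) ((1 - z J) * ((\<Prod>j<J. 1 - fps_X ^ (m * Suc j)) * T J))"
      by (rule fps_eq_upto_mult[OF fps_eq_upto_refl Suc])
    moreover have "fps_eq_upto N ((\<Prod>j<J. 1 - fps_X ^ (m * Suc j)) * ((1 - z J) * T J))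
        ((\<Prod>j<J. 1 - fps_X ^ (m * Suc j)) * ((1 - fps_X ^ (m * Suc J)) * T (Suc J)))"
      by (rule fps_eq_upto_mult[OF fps_eq_upto_refl step])
    ultimately show ?case
      unfolding prod.lessThan_Suc by (simp only: mult_ac) (blast intro: fps_eq_upto_trans)
  qed (simp add: fps_eq_upto_refl)
  \<comment> \<open>After \<open>N\<close> steps every term with \<open>s > 0\<close> is divisible
    by X^N, and only \<open>c 0 = 1\<close> survives.\<close>
  have T_N: "fps_eq_upto N (T N) 1"
  proof -
    have "fps_eq_upto N (z N ^ s * c s) (if s = 0 then 1 else 0)" for s
    proof (cases s)
      case (Suc s')
      have "N \<le> m * N"
        using assms by (cases m) auto
      also have "\<dots> \<le> m - k + m * N"
        by simp
      also have "\<dots> \<le> (m - k + m * N) * s"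
        using Suc by simp
      finally have "N \<le> (m - k + m * N) * s" .
      then have "fps_eq_upto N (z N ^ s * c s) 0"
        unfolding z_def power_mult[symmetric] by (rule fps_eq_upto_X_power)
      then show ?thesis
        using Suc by simp
    qed (simp add: c0 fps_eq_upto_refl)
    then show ?thesis
      unfolding T_def fps_eq_upto_def fps_sum_nth
      by (auto simp: if_distrib[of "\<lambda>f. f $ n" for n] sum.delta cong: if_cong)
  qed
  have C: "fps_eq_upto N (?C * euler (?R k)) (T 0)"
  proof -
    let ?F = "\<lambda>s. gf {\<pi> \<in> capsids m k. count \<pi> (m - k) = s} (\<lambda>_. 1) (\<lambda>\<pi>. int (\<Sum>\<^sub># \<pi>))"
    \<comment> \<open>A partition of \<open>n < N\<close> contains \<open>m - k\<close> at most
      \<open>n\<close> times, so the multiplicities up to \<open>N\<close> exhaust the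
      coefficient.\<close>
    have "fps_eq_upto N ?C (\<Sum>s\<le>N. ?F s)"
      unfolding fps_eq_upto_def
    proof (intro allI impI)
      fix n assume "n < N"
      let ?S = "{\<pi>. \<pi> \<in> capsids m k \<and> int (\<Sum>\<^sub># \<pi>) = int n}"
      have "(\<Sum>s\<le>N. ?F s) $ n = (\<Sum>s\<le>N. \<Sum>\<pi> | \<pi> \<in> ?S \<and> count \<pi> (m - k) = s. 1)"
        unfolding fps_sum_nth gf_nth by (intro sum.cong) auto
      also have "\<dots> = (\<Sum>\<pi>\<in>?S. 1)"
      proof (rule sum.group)
        show "(\<lambda>\<pi>. count \<pi> (m - k)) ` ?S \<subseteq> {..N}"
        proof (rule image_subsetI)
          fix \<pi> assume "\<pi> \<in> ?S"
          then show "count \<pi> (m - k) \<in> {..N}"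
            using assms \<open>n < N\<close> count_le_sum_mset[of "m - k" \<pi>] by simp
        qed
      qed (use graded_finite[OF graded_capsids] in auto)
      finally show "?C $ n = (\<Sum>s\<le>N. ?F s) $ n"
        by (simp only: gf_nth)
    qed
    then have "fps_eq_upto N (?C * euler (?R k)) ((\<Sum>s\<le>N. ?F s) * euler (?R k))"
      by (intro fps_eq_upto_mult fps_eq_upto_refl)
    also have "(\<Sum>s\<le>N. ?F s) * euler (?R k) = T 0"
      unfolding T_def sum_distrib_right
    proof (rule sum.cong[OF refl])
      fix s
      have "?R k = ?A s \<union> ?U s" "?A s \<inter> ?U s = {}"
        by auto
      then have "euler (?R k) = euler (?A s) * euler (?U s)"
        using euler_Un by metis
      moreover have "euler (?U s) * part_gf (?U s) = 1"
        by (rule euler_part_gf) (simp add: residue_class_def)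
      moreover have "?F s * euler (?R k) = fps_X ^ (s * (m - k)) * part_gf (?D s) * (part_gf (?U s) * euler (?R k))"
        unfolding gf_capsids_count[OF assms] by (simp only: mult.assoc)
      ultimately have "?F s * euler (?R k) = fps_X ^ (s * (m - k)) * (part_gf (?D s) * euler (?A s))"
        by (simp add: mult_ac)
      then show "?F s * euler (?R k) = z 0 ^ s * c s"
        by (simp add: z0 c_def mult.commute[of s] flip: power_mult)
    qed
    finally show ?thesis .
  qed
  have below: "?R r \<inter> {..<N} = (\<lambda>j. r + m * j) ` {..<N} \<inter> {..<N}" if "0 < r" "r < m" for r
  proof (intro equalityI subsetI)
    fix p assume p: "p \<in> ?R r \<inter> {..<N}"
    then have "p = r + m * (p div m)" "p div m < N"
      by (auto simp: residue_class_def intro: le_less_trans[OF div_le_dividend])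
    then show "p \<in> (\<lambda>j. r + m * j) ` {..<N} \<inter> {..<N}"
      using p by blast
  qed (use that in \<open>auto simp: residue_class_def\<close>)
  have inj: "inj_on (\<lambda>j. r + m * j) {..<N}" for r
    using assms by (auto simp: inj_on_def)
  have "fps_eq_upto N (euler (?R (m - k))) (euler ((\<lambda>j. m - k + m * j) ` {..<N}))"
    using assms by (intro euler_eq_upto below) auto
  also have "euler ((\<lambda>j. m - k + m * j) ` {..<N}) = (\<Prod>j<N. 1 - z j)"
    by (simp only: euler_finite finite_imageI finite_lessThan prod.reindex[OF inj] o_def z_def)
  finally have E1: "fps_eq_upto N (euler (?R (m - k))) (\<Prod>j<N. 1 - z j)" .
  have "?R 0 \<inter> {..<N} = (\<lambda>j. m * Suc j) ` {..<N} \<inter> {..<N}"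
  proof (intro equalityI subsetI)
    fix p assume p: "p \<in> ?R 0 \<inter> {..<N}"
    then have *: "p = m * (p div m)" "p div m < N" "0 < p"
      by (auto simp: residue_class_def intro: le_less_trans[OF div_le_dividend])
    then have "0 < p div m"
      by (metis gr0I mult_0_right)
    then have "p = m * Suc (p div m - 1)" "p div m - 1 < N"
      using * by simp_all
    then show "p \<in> (\<lambda>j. m * Suc j) ` {..<N} \<inter> {..<N}"
      using p by blast
  qed (use assms in \<open>auto simp: residue_class_def\<close>)
  then have "fps_eq_upto N (euler (?R 0)) (euler ((\<lambda>j. m * Suc j) ` {..<N}))"
    by (rule euler_eq_upto)
  also have "euler ((\<lambda>j. m * Suc j) ` {..<N}) = (\<Prod>j<N. 1 - fps_X ^ (m * Suc j))"
    using assms by (subst euler_finite) (auto simp: prod.reindex inj_on_def simp del: mult_Suc_right)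
  finally have E2: "fps_eq_upto N (euler (?R 0)) (\<Prod>j<N. 1 - fps_X ^ (m * Suc j))" .
  have "fps_eq_upto N (?C * euler (?R k) * euler (?R (m - k))) (T 0 * (\<Prod>j<N. 1 - z j))"
    by (rule fps_eq_upto_mult[OF C E1])
  moreover have "fps_eq_upto N (T 0 * (\<Prod>j<N. 1 - z j)) ((\<Prod>j<N. 1 - fps_X ^ (m * Suc j)) * T N)"
    using tele[of N] by (simp only: mult.commute)
  moreover have "fps_eq_upto N ((\<Prod>j<N. 1 - fps_X ^ (m * Suc j)) * T N) (euler (?R 0) * 1)"
    by (rule fps_eq_upto_mult[OF fps_eq_upto_sym[OF E2] T_N])
  ultimately show "fps_eq_upto N (?C * (euler (?R k) * euler (?R (m - k)))) (euler (?R 0))"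
    unfolding fps_eq_upto_def mult.assoc by simp
qed

section \<open>Ramanujan's tau function\<close>

text \<open>Passes from modulus 5 of the Rogers-Ramanujan products to modulus 10 of the capsids: the
  classes 1, 6 and 4, 9 regroup as 1, 9 and 4, 6, and similarly 2, 7 and 3, 8 as 2, 8 and 3,
  7.\<close>

lemma euler_residue_class_double:
  assumes "k < m"
  shows "euler (residue_class m k) = euler (residue_class (2 * m) k) * euler (residue_class (2 * m) (k + m))"
proof -
  have "residue_class m k = residue_class (2 * m) k \<union> residue_class (2 * m) (k + m)"
  proof (intro equalityI subsetI)
    fix n assume n: "n \<in> residue_class m k"
    have "n mod (2 * m) = m * (n div m mod 2) + n mod m"
      by (simp add: mod_mult2_eq mult.commute[of 2])
    then show "n \<in> residue_class (2 * m) k \<union> residue_class (2 * m) (k + m)"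
      using n by (cases "even (n div m)") (auto simp: residue_class_def even_iff_mod_2_eq_zero odd_iff_mod_2_eq_one)
  next
    fix n assume "n \<in> residue_class (2 * m) k \<union> residue_class (2 * m) (k + m)"
    then have "0 < n" "n mod (2 * m) mod m = k"
      using assms by (auto simp: residue_class_def)
    then show "n \<in> residue_class m k"
      by (simp add: residue_class_def mod_mod_cancel)
  qed
  moreover have "residue_class (2 * m) k \<inter> residue_class (2 * m) (k + m) = {}"
    using assms by (auto simp: residue_class_def)
  ultimately show ?thesis
    by (simp add: euler_Un)
qed

text \<open>Euler's pentagonal number theorem: for modulus 3 the three factors of the triple product
  exhaust all positive exponents.\<close>

lemma theta_3_1: "theta 3 1 = euler {1..}"
proof -
  have "n mod 3 = 1 \<or> n mod 3 = 2 \<or> n mod 3 = 0" for n :: nat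
    by presburger
  then have "{1..} = (residue_class 3 1 \<union> residue_class 3 2) \<union> residue_class 3 0"
    by (auto simp: residue_class_def Suc_le_eq)
  moreover have "(residue_class 3 1 \<union> residue_class 3 2) \<inter> residue_class 3 0 = {}" "residue_class 3 1 \<inter> residue_class 3 2 = {}"
    by (auto simp: residue_class_def)
  ultimately have "euler {1..} = euler (residue_class 3 1) * euler (residue_class 3 2) * euler (residue_class 3 0)"
    by (simp only: euler_Un)
  then show ?thesis
    using jacobi_triple_product[of 1 3] by simp
qed

lemma euler_mod_5:
  "euler {1..} = euler (residue_class 5 1) * euler (residue_class 5 4) *
    (euler (residue_class 5 2) * euler (residue_class 5 3)) * euler (residue_class 5 0)"
proof -
  have "n mod 5 = 1 \<or> n mod 5 = 4 \<or> n mod 5 = 2 \<or> n mod 5 = 3 \<or> n mod 5 = 0" for n :: nat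
    by presburger
  then have "{1..} = ((residue_class 5 1 \<union> residue_class 5 4) \<union> (residue_class 5 2 \<union> residue_class 5 3)) \<union> residue_class 5 0"
    by (auto simp: residue_class_def Suc_le_eq)
  moreover have "((residue_class 5 1 \<union> residue_class 5 4) \<union> (residue_class 5 2 \<union> residue_class 5 3)) \<inter> residue_class 5 0 = {}"
    "(residue_class 5 1 \<union> residue_class 5 4) \<inter> (residue_class 5 2 \<union> residue_class 5 3) = {}"
    "residue_class 5 1 \<inter> residue_class 5 4 = {}" "residue_class 5 2 \<inter> residue_class 5 3 = {}"
    by (auto simp: residue_class_def)
  ultimately show ?thesis
    by (simp only: euler_Un)
qed

abbreviation size_gf :: "nat multiset set \<Rightarrow> int fps" where
  "size_gf S \<equiv> gf S (\<lambda>_. 1) (\<lambda>\<pi>. int (\<Sum>\<^sub># \<pi>))"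

lemma euler_nonzero: "0 \<notin> J \<Longrightarrow> euler J \<noteq> 0"
  using euler_part_gf[of J] by auto

lemma compose_X_power_nonzero:
  assumes "c > 0" "f \<noteq> 0"
  shows "f oo fps_X ^ c \<noteq> (0 :: int fps)"
proof -
  obtain n where "f $ n \<noteq> 0"
    using assms(2) by (auto simp: fps_eq_iff)
  then have "(f oo fps_X ^ c) $ (c * n) \<noteq> 0"
    using assms(1) by (simp add: fps_nth_compose_X_power)
  then show ?thesis
    by (metis fps_zero_nth)
qed

lemma compose_X_power_mult: "c > 0 \<Longrightarrow> (f * g) oo fps_X ^ c = (f oo fps_X ^ c) * (g oo fps_X ^ c :: int fps)"
  by (rule fps_compose_mult_distrib) simp

lemma compose_X_power_compose:
  "c > 0 \<Longrightarrow> d > 0 \<Longrightarrow> (f oo fps_X ^ c) oo fps_X ^ d = (f oo fps_X ^ (d * c) :: int fps)"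
  by (simp add: fps_X_power_compose power_mult flip: fps_compose_assoc)

text \<open>To stay free of quotients, the claim is proved after multiplication by phi(q) phi(q^11),
  which is nonzero and is cancelled at the end.\<close>

lemma capsid_core_identity:
  defines "C \<equiv> \<lambda>k. size_gf (capsids 10 k)" and "K \<equiv> size_gf (cores 11) oo fps_X ^ 10"
  shows "C 2 * C 3 * ((C 1 * C 4) oo fps_X ^ 11) * K ^ 2 -
    fps_X ^ 2 * (C 1 * C 4 * ((C 2 * C 3) oo fps_X ^ 11) * K ^ 2) = euler {1..} ^ 24 oo fps_X ^ 110"
proof -
  define \<phi> where "\<phi> = euler {1..}"
  define up :: "nat \<Rightarrow> int fps \<Rightarrow> int fps" where "up = (\<lambda>c f. f oo fps_X ^ c)"
  \<comment> \<open>The reciprocals of the Rogers-Ramanujan functions: \<open>g\<close> is 1/G and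
    \<open>h\<close> is 1/H.\<close>
  define g h where "g = euler (residue_class 5 1) * euler (residue_class 5 4)"
    and "h = euler (residue_class 5 2) * euler (residue_class 5 3)"
  have up_mult: "up c (f * f') = up c f * up c f'" if "c > 0" for c f f'
    using that by (simp add: up_def compose_X_power_mult)
  have up_up: "up d (up c f) = up (d * c) f" if "c > 0" "d > 0" for c d f
    using that by (simp add: up_def compose_X_power_compose)
  have up_power: "up c (f ^ n) = up c f ^ n" if "c > 0" for c f n
    using that by (simp add: up_def fps_compose_power)
  have R0: "euler (residue_class m 0) = up m \<phi>" if "m > 0" for m
    using that by (simp add: residue_class_0 euler_scale \<phi>_def up_def)
  have t51: "theta 5 1 = g * up 5 \<phi>" and t52: "theta 5 2 = h * up 5 \<phi>"
    using jacobi_triple_product[of 1 5] jacobi_triple_product[of 2 5] by (simp_all add: g_def h_def R0)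
  have ghphi: "\<phi> = g * h * up 5 \<phi>"
    unfolding \<phi>_def g_def h_def using euler_mod_5 R0[of 5] by (simp add: \<phi>_def)
  have C: "C k * (euler (residue_class 10 k) * euler (residue_class 10 (10 - k))) = up 10 \<phi>" if "0 < k" "k < 5" for k
    using gf_capsids[of k 10] that R0[of 10] by (simp add: C_def)
  have "g = (euler (residue_class 10 1) * euler (residue_class 10 9)) * (euler (residue_class 10 4) * euler (residue_class 10 6))"
    using euler_residue_class_double[of 1 5] euler_residue_class_double[of 4 5] by (simp add: g_def mult_ac)
  then have Cg: "C 1 * C 4 * g = up 10 \<phi> ^ 2"
    using arg_cong2[OF C[of 1] C[of 4], of "(*)"] by (simp add: power2_eq_square mult_ac)
  have "h = (euler (residue_class 10 2) * euler (residue_class 10 8)) * (euler (residue_class 10 3) * euler (residue_class 10 7))"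
    using euler_residue_class_double[of 2 5] euler_residue_class_double[of 3 5] by (simp add: h_def mult_ac)
  then have Ch: "C 2 * C 3 * h = up 10 \<phi> ^ 2"
    using arg_cong2[OF C[of 2] C[of 3], of "(*)"] by (simp add: power2_eq_square mult_ac)
  have K: "K * up 10 \<phi> = up 110 \<phi> ^ 11"
    using arg_cong[OF gf_cores[of 11], of "up 10"] up_mult[of 10] up_power[of 10] up_up[of 11 10]
    by (simp add: K_def \<phi>_def) (simp add: up_def)
  have id: "g * up 5 \<phi> * (up 11 h * up 55 \<phi>) - fps_X ^ 2 * (h * up 5 \<phi> * (up 11 g * up 55 \<phi>)) = \<phi> * up 11 \<phi>"
  proof -
    have "theta 5 1 * up 11 (theta 5 2) - fps_X ^ 2 * (theta 5 2 * up 11 (theta 5 1)) = \<phi> * up 11 \<phi>"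
      using theta_identity_11 unfolding theta_3_1 by (simp only: up_def \<phi>_def)
    then show ?thesis
      unfolding t51 t52 by (simp add: up_mult up_up)
  qed
  have ghphi11: "up 11 \<phi> = up 11 g * up 11 h * up 55 \<phi>"
    using arg_cong[OF ghphi, of "up 11"] by (simp add: up_mult up_up)
  have Cg11: "up 11 (C 1 * C 4) * up 11 g = up 110 \<phi> ^ 2" and Ch11: "up 11 (C 2 * C 3) * up 11 h = up 110 \<phi> ^ 2"
    using arg_cong[OF Cg, of "up 11"] arg_cong[OF Ch, of "up 11"]
    by (simp_all only: up_mult up_power up_up zero_less_numeral) simp_all
  define A B where "A = C 2 * C 3 * up 11 (C 1 * C 4) * K ^ 2" and "B = C 1 * C 4 * up 11 (C 2 * C 3) * K ^ 2"
  \<comment> \<open>Expanding the multiplier supplies one factor \<open>g\<close> or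
    \<open>h\<close> for each capsid pair; the factors left over in the two summands are precisely
    the theta products in \<open>id\<close>.\<close>
  have "(A - fps_X ^ 2 * B) * (\<phi> * up 11 \<phi>) =
      (A - fps_X ^ 2 * B) * (g * h * up 5 \<phi> * (up 11 g * up 11 h * up 55 \<phi>))"
    using ghphi ghphi11 by simp
  also have "\<dots> = K ^ 2 * ((C 2 * C 3 * h) * (up 11 (C 1 * C 4) * up 11 g) * (g * up 5 \<phi> * (up 11 h * up 55 \<phi>)) -
      (C 1 * C 4 * g) * (up 11 (C 2 * C 3) * up 11 h) * (fps_X ^ 2 * (h * up 5 \<phi> * (up 11 g * up 55 \<phi>))))"
    unfolding A_def B_def by (simp add: algebra_simps)
  also have "\<dots> = K ^ 2 * (up 10 \<phi> ^ 2 * up 110 \<phi> ^ 2) *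
      (g * up 5 \<phi> * (up 11 h * up 55 \<phi>) - fps_X ^ 2 * (h * up 5 \<phi> * (up 11 g * up 55 \<phi>)))"
    unfolding Cg Ch Cg11 Ch11 by (simp add: algebra_simps)
  also have "\<dots> = (K * up 10 \<phi>) ^ 2 * up 110 \<phi> ^ 2 * (\<phi> * up 11 \<phi>)"
    unfolding id by (simp add: power_mult_distrib mult_ac)
  also have "(K * up 10 \<phi>) ^ 2 * up 110 \<phi> ^ 2 = up 110 \<phi> ^ 24"
    unfolding K by (simp flip: power_mult power_add)
  finally have "(A - fps_X ^ 2 * B) * (\<phi> * up 11 \<phi>) = up 110 \<phi> ^ 24 * (\<phi> * up 11 \<phi>)" .
  moreover have "\<phi> * up 11 \<phi> \<noteq> 0"
    using euler_nonzero[of "{1..}"] compose_X_power_nonzero[of 11 \<phi>] by (simp add: \<phi>_def up_def)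
  ultimately have "A - fps_X ^ 2 * B = up 110 \<phi> ^ 24"
    by simp
  then show ?thesis
    unfolding A_def B_def up_def \<phi>_def by (simp add: fps_compose_power)
qed

lemma gf_weighted_size:
  assumes "\<And>\<pi>. \<pi> \<in> A \<union> B \<union> C \<union> D \<union> E \<union> F \<Longrightarrow> is_partition \<pi>"
  shows "Abs_fps (\<lambda>n. int (card {x \<in> A \<times> B \<times> C \<times> D \<times> E \<times> F. weighted_size x = n})) =
    size_gf A * size_gf B * ((size_gf C * size_gf D) oo fps_X ^ 11) *
      ((size_gf E oo fps_X ^ 10) * (size_gf F oo fps_X ^ 10))"
proof -
  have gr: "graded S (\<lambda>\<pi>. int (\<Sum>\<^sub># \<pi>))" if "S \<subseteq> A \<union> B \<union> C \<union> D \<union> E \<union> F" for S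
  proof (rule graded_subset[OF graded_partitions[of "{1..}"]])
    have "S \<subseteq> {\<pi>. is_partition \<pi>}"
      using assms that by blast
    then show "S \<subseteq> {\<pi>. set_mset \<pi> \<subseteq> {1..}}"
      unfolding is_partition_iff .
  qed simp
  have g1: "graded A (\<lambda>\<pi>. int (\<Sum>\<^sub># \<pi>))" "graded B (\<lambda>\<pi>. int (\<Sum>\<^sub># \<pi>))" "graded C (\<lambda>\<pi>. int (\<Sum>\<^sub># \<pi>))"
    "graded D (\<lambda>\<pi>. int (\<Sum>\<^sub># \<pi>))" "graded E (\<lambda>\<pi>. int (\<Sum>\<^sub># \<pi>))" "graded F (\<lambda>\<pi>. int (\<Sum>\<^sub># \<pi>))"
    by (auto intro!: gr)
  have scale: "graded S (\<lambda>\<pi>. int c * int (\<Sum>\<^sub># \<pi>))"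
    "size_gf S oo fps_X ^ c = gf S (\<lambda>_. 1) (\<lambda>\<pi>. int c * int (\<Sum>\<^sub># \<pi>))"
    if "graded S (\<lambda>\<pi>. int (\<Sum>\<^sub># \<pi>))" "c \<in> {10, 11}" for S and c :: nat
    using that graded_scale[OF that(1), of c] gf_scale[OF that(1), of c "\<lambda>_. 1"] by auto
  have c: "11 \<in> {10, 11 :: nat}" "10 \<in> {10, 11 :: nat}"
    by simp_all
  note gE = scale(1)[OF g1(5) c(2)] and gF = scale(1)[OF g1(6) c(2)]
    and gC = scale(1)[OF g1(3) c(1)] and gD = scale(1)[OF g1(4) c(1)]
  note gEF = graded_times[OF gE gF]
  note gDF = graded_times[OF gD gEF]
  note gCF = graded_times[OF gC gDF]
  note gBF = graded_times[OF g1(2) gCF]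
  have "size_gf A * size_gf B * ((size_gf C * size_gf D) oo fps_X ^ 11) *
      ((size_gf E oo fps_X ^ 10) * (size_gf F oo fps_X ^ 10)) =
    size_gf A * (size_gf B * ((size_gf C oo fps_X ^ 11) * ((size_gf D oo fps_X ^ 11) *
      ((size_gf E oo fps_X ^ 10) * (size_gf F oo fps_X ^ 10)))))"
    by (simp add: compose_X_power_mult mult.assoc)
  also have "\<dots> = gf (A \<times> B \<times> C \<times> D \<times> E \<times> F) (\<lambda>_. 1) (\<lambda>x. int (weighted_size x))"
    unfolding scale(2)[OF g1(3) c(1)] scale(2)[OF g1(4) c(1)] scale(2)[OF g1(5) c(2)] scale(2)[OF g1(6) c(2)]
      gf_times[OF gE gF] gf_times[OF gD gEF] gf_times[OF gC gDF] gf_times[OF g1(2) gCF] gf_times[OF g1(1) gBF]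
    by (rule gf_cong) auto
  finally show ?thesis
    by (simp add: gf_def)
qed

theorem theorem4p1:
  fixes n :: nat
  assumes "n \<ge> 1"
  shows "ramanujan_tau n = int (count_a (110 * n - 110)) - int (count_b (110 * int n - 112)) \<and>
    (\<not> [n = 0] (mod 110) \<longrightarrow> int (count_a n) - int (count_b (int n - 2)) = 0)"
proof -
  define A B where "A = Abs_fps (\<lambda>n. int (count_a n))" and "B = Abs_fps (\<lambda>n. int (count_b (int n)))"
  let ?C = "\<lambda>k. size_gf (capsids 10 k)" and ?K = "size_gf (cores 11) oo fps_X ^ 10"
  have part: "is_partition \<pi>" if "\<pi> \<in> capsids 10 j \<union> capsids 10 k \<union> capsids 10 j' \<union> capsids 10 k' \<union> cores 11 \<union> cores 11"
    for \<pi> j k j' k'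
    using that by (auto simp: capsids_def cores_def)
  have A: "A = ?C 2 * ?C 3 * ((?C 1 * ?C 4) oo fps_X ^ 11) * ?K ^ 2"
    unfolding A_def count_a_def power2_eq_square by (rule gf_weighted_size[OF part])
  have B: "B = ?C 1 * ?C 4 * ((?C 2 * ?C 3) oo fps_X ^ 11) * ?K ^ 2"
  proof -
    have "B = Abs_fps (\<lambda>n. int (card {x \<in> capsids 10 1 \<times> capsids 10 4 \<times> capsids 10 2 \<times> capsids 10 3 \<times>
        cores 11 \<times> cores 11. weighted_size x = n}))"
      by (simp add: B_def count_b_def)
    then show ?thesis
      unfolding power2_eq_square by (simp only: gf_weighted_size[OF part])
  qed
  have id: "A - fps_X ^ 2 * B = euler {1..} ^ 24 oo fps_X ^ 110"
    unfolding A B by (rule capsid_core_identity)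
  \<comment> \<open>The values 0 of \<open>count_b\<close> at -2 and -1 cover \<open>k < 2\<close>,
    where multiplication by X^2 leaves nothing. Degrees not divisible by 110 give (ii); degree 110
    (n - 1) gives (i), with n - 1 because of the extra factor X in the definition of tau.\<close>
  have coeff: "int (count_a k) - int (count_b (int k - 2)) =
      (if 110 dvd k then (euler {1..} ^ 24) $ (k div 110) else 0)" for k
  proof -
    have "(A - fps_X ^ 2 * B) $ k = int (count_a k) - int (count_b (int k - 2))"
    proof (cases "k < 2")
      case True
      then have "count_b (int k - 2) = 0"
        by (simp add: count_b_def)
      then show ?thesis
        using True by (simp add: A_def fps_X_power_mult_nth)
    next
      case False
      then have "int (k - 2) = int k - 2"
        by simp
      then show ?thesis
        using False by (simp add: A_def B_def fps_X_power_mult_nth del: of_nat_diff)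
    qed
    then show ?thesis
      unfolding id by (simp only: fps_nth_compose_X_power)
  qed
  have "ramanujan_tau n = (euler {1..} ^ 24) $ (n - 1)"
    unfolding ramanujan_tau_def tau_prodinf using assms by (simp add: fps_X_mult_nth)
  moreover have "int (count_a (110 * n - 110)) - int (count_b (110 * int n - 112)) = (euler {1..} ^ 24) $ (n - 1)"
  proof -
    obtain k where k: "n = Suc k"
      using assms by (cases n) auto
    show ?thesis
      using coeff[of "110 * k"] by (simp add: k algebra_simps)
  qed
  moreover have "int (count_a n) - int (count_b (int n - 2)) = 0" if "\<not> [n = 0] (mod 110)"
    using coeff[of n] that by (simp add: cong_0_iff)
  ultimately show ?thesis
    by simp
qed

end
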